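(* Let $M$ be an $L$-structure with trivial definable closure, where $L$ is a countable language. Then there is a model $N$ elementarily equivalent to $M$, of cardinality $2^{\aleph_0}$, satisfying: (1) The universe of $N$ is indexed (bijectively) as $2^\omega\times\omega$, say $N=\{a_{\eta,i}:\eta\in 2^\omega,i\in\omega\}$; (2) $N=\bigcup_{i\in\omega}A_i$ is a partition where, for each $i$, $A_i=\{a_{\eta,i}:\eta\in 2^\omega\}$ is an asymptotically similar subset; (3) With respect to the natural Polish topology on $2^\omega\times\omega$ (and the product topology on $(2^\omega\times\omega)^k$), for every $k$, every definable subset of $N^k$ is a finite Boolean combination of open sets of $(2^\omega\times\omega)^k$; (4) With respect to the measure $\mu$ on $2^\omega\times\omega$ described below and its product measure on $(2^\omega\times\omega)^k$, for every $k$ every non-degenerate definable subset of $N^k$ has positive measure; (5) If, in addition, $M$ is atomic, then $N$ can also be chosen to be atomic; (6) More generally, if $\{\Delta_m:m\in\omega\}$ is a countable set of types omitted by $M$, then $N$ can also be chosen to omit each $\Delta_m$.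
   Context: For a subset $A$ of an $L$-structure $M$, ${\rm dcl}(A)$ is the set of $b\in M$ such that some formula $\varphi(x,\bar a)$ with $\bar a$ from $A$ has $b$ as its unique solution in $M$. $M$ has trivial definable closure if ${\rm dcl}(A)=A$ for every $A\subseteq M$. Definable means definable with parameters from $N$. A definable set $\psi(N^k,\bar b)$ is non-degenerate if it contains some $(a_1,\dots,a_k)$ with $a_1,\dots,a_k$ pairwise distinct and disjoint from $\bar b$. Topology: $2^\omega$ has the Cantor topology with basic open sets $U_a=\{\eta\in 2^\omega:a\triangleleft\eta\}$ for $a\in 2^{<\omega}$, and $2^\omega\times\omega$ has basic open sets $U_a\times\{i\}$. Measure: $\mu(U_a\times\{i\})=2^{-(n+i+1)}$ where $n$ is the length of $a$, extended to a Borel measure. A model is atomic if every finite tuple satisfies a formula that is complete with respect to the theory (isolates a complete type). Asymptotic similarity: $k$-tuples $(\eta_0,\dots,\eta_{k-1})$, $(\tau_0,\dots,\tau_{k-1})$ of distinct elements of $2^\omega$ are similar mod $\ell$ if $\eta_0|\ell,\dots,\eta_{k-1}|\ell$ are distinct and $\eta_j|\ell=\tau_j|\ell$ for all $j$. A subset $\{a_\eta:\eta\in 2^\omega\}$ of $N$ is asymptotically similar if for every $L$-formula $\theta$ in $k$ variables there is $N_\theta$ such that for every $\ell\ge N_\theta$ and all $k$-tuples $\bar\eta,\bar\tau$ similar mod $\ell$, $N\models\theta(a_{\eta_0},\dots,a_{\eta_{k-1}})\leftrightarrow\theta(a_{\tau_0},\dots,a_{\tau_{k-1}})$. *)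

theory Defs
  imports "HOL-Probability.Probability" "HOL-Library.Equipollence"
begin

section \<open>First-order languages, formulas and structures\<close>

record ('f, 'r) language =
  funs :: "'f set"
  rels :: "'r set"
  fun_ar :: "'f \<Rightarrow> nat"
  rel_ar :: "'r \<Rightarrow> nat"

definition countable_language :: "('f, 'r) language \<Rightarrow> bool" where
  "countable_language L \<longleftrightarrow> countable (funs L) \<and> countable (rels L)"

datatype 'f tm = Var nat | App 'f "'f tm list"

datatype ('f, 'r) fm =
    Eq "'f tm" "'f tm"
  | Rel 'r "'f tm list"
  | Neg "('f, 'r) fm"
  | Conj "('f, 'r) fm" "('f, 'r) fm"
  | Exi nat "('f, 'r) fm"

fun wf_tm :: "('f, 'r) language \<Rightarrow> 'f tm \<Rightarrow> bool" where
  "wf_tm L (Var n) \<longleftrightarrow> True"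
| "wf_tm L (App f ts) \<longleftrightarrow> f \<in> funs L \<and> length ts = fun_ar L f \<and> (\<forall>t\<in>set ts. wf_tm L t)"

fun fv_tm :: "'f tm \<Rightarrow> nat set" where
  "fv_tm (Var n) = {n}"
| "fv_tm (App f ts) = (\<Union>t\<in>set ts. fv_tm t)"

fun wf_fm :: "('f, 'r) language \<Rightarrow> ('f, 'r) fm \<Rightarrow> bool" where
  "wf_fm L (Eq s t) \<longleftrightarrow> wf_tm L s \<and> wf_tm L t"
| "wf_fm L (Rel r ts) \<longleftrightarrow> r \<in> rels L \<and> length ts = rel_ar L r \<and> (\<forall>t\<in>set ts. wf_tm L t)"
| "wf_fm L (Neg \<phi>) \<longleftrightarrow> wf_fm L \<phi>"
| "wf_fm L (Conj \<phi> \<psi>) \<longleftrightarrow> wf_fm L \<phi> \<and> wf_fm L \<psi>"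
| "wf_fm L (Exi n \<phi>) \<longleftrightarrow> wf_fm L \<phi>"

fun fv :: "('f, 'r) fm \<Rightarrow> nat set" where
  "fv (Eq s t) = fv_tm s \<union> fv_tm t"
| "fv (Rel r ts) = (\<Union>t\<in>set ts. fv_tm t)"
| "fv (Neg \<phi>) = fv \<phi>"
| "fv (Conj \<phi> \<psi>) = fv \<phi> \<union> fv \<psi>"
| "fv (Exi n \<phi>) = fv \<phi> - {n}"

text \<open>Formulas in the \<open>k\<close> free variables \<open>0, \<dots>, k - 1\<close>.\<close>

definition formula :: "('f, 'r) language \<Rightarrow> nat \<Rightarrow> ('f, 'r) fm \<Rightarrow> bool" where
  "formula L k \<phi> \<longleftrightarrow> wf_fm L \<phi> \<and> fv \<phi> \<subseteq> {..<k}"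

record ('f, 'r, 'a) fo_struct =
  univ :: "'a set"
  fn :: "'f \<Rightarrow> 'a list \<Rightarrow> 'a"
  rl :: "'r \<Rightarrow> 'a list \<Rightarrow> bool"

definition is_struct :: "('f, 'r) language \<Rightarrow> ('f, 'r, 'a) fo_struct \<Rightarrow> bool" where
  "is_struct L M \<longleftrightarrow> univ M \<noteq> {} \<and>
     (\<forall>f\<in>funs L. \<forall>xs. length xs = fun_ar L f \<and> set xs \<subseteq> univ M \<longrightarrow> fn M f xs \<in> univ M)"

fun val :: "('f, 'r, 'a) fo_struct \<Rightarrow> (nat \<Rightarrow> 'a) \<Rightarrow> 'f tm \<Rightarrow> 'a" where
  "val M e (Var n) = e n"
| "val M e (App f ts) = fn M f (map (val M e) ts)"

fun sat :: "('f, 'r, 'a) fo_struct \<Rightarrow> (nat \<Rightarrow> 'a) \<Rightarrow> ('f, 'r) fm \<Rightarrow> bool" where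
  "sat M e (Eq s t) \<longleftrightarrow> val M e s = val M e t"
| "sat M e (Rel r ts) \<longleftrightarrow> rl M r (map (val M e) ts)"
| "sat M e (Neg \<phi>) \<longleftrightarrow> \<not> sat M e \<phi>"
| "sat M e (Conj \<phi> \<psi>) \<longleftrightarrow> sat M e \<phi> \<and> sat M e \<psi>"
| "sat M e (Exi n \<phi>) \<longleftrightarrow> (\<exists>x\<in>univ M. sat M (e(n := x)) \<phi>)"

definition Th :: "('f, 'r) language \<Rightarrow> ('f, 'r, 'a) fo_struct \<Rightarrow> ('f, 'r) fm set" where
  "Th L M = {\<sigma>. formula L 0 \<sigma> \<and> (\<forall>e. range e \<subseteq> univ M \<longrightarrow> sat M e \<sigma>)}"

text \<open>The two structures may live on different types.\<close>

definition elem_equiv ::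
  "('f, 'r) language \<Rightarrow> ('f, 'r, 'a) fo_struct \<Rightarrow> ('f, 'r, 'b) fo_struct \<Rightarrow> bool" where
  "elem_equiv L M N \<longleftrightarrow> Th L M = Th L N"

section \<open>Definability, types, atomic structures\<close>

text \<open>
  Throughout, a \<open>k\<close>-tuple of elements of \<open>X\<close> is an element of \<open>{..<k} \<rightarrow>\<^sub>E X\<close>.  In a formula with
  parameters the variables below \<open>k\<close> stand for the tuple and the variables \<open>k + j\<close> for the
  parameters \<open>b j\<close>.
\<close>

definition join :: "nat \<Rightarrow> (nat \<Rightarrow> 'a) \<Rightarrow> (nat \<Rightarrow> 'a) \<Rightarrow> nat \<Rightarrow> 'a" where
  "join k x b = (\<lambda>j. if j < k then x j else b (j - k))"

definition solutions ::
  "('f, 'r, 'a) fo_struct \<Rightarrow> nat \<Rightarrow> ('f, 'r) fm \<Rightarrow> (nat \<Rightarrow> 'a) \<Rightarrow> (nat \<Rightarrow> 'a) set" where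
  "solutions M k \<phi> b = {x \<in> {..<k} \<rightarrow>\<^sub>E univ M. sat M (join k x b) \<phi>}"

definition dcl :: "('f, 'r) language \<Rightarrow> ('f, 'r, 'a) fo_struct \<Rightarrow> 'a set \<Rightarrow> 'a set" where
  "dcl L M A = {b \<in> univ M. \<exists>m \<phi>. \<exists>a \<in> {..<m} \<rightarrow>\<^sub>E A.
      formula L (1 + m) \<phi> \<and> (\<forall>c\<in>univ M. sat M (join 1 (\<lambda>_. c) a) \<phi> \<longleftrightarrow> c = b)}"

definition trivial_dcl :: "('f, 'r) language \<Rightarrow> ('f, 'r, 'a) fo_struct \<Rightarrow> bool" where
  "trivial_dcl L M \<longleftrightarrow> (\<forall>A \<subseteq> univ M. dcl L M A = A)"

text \<open>Non-degeneracy depends on the presentation \<open>\<phi>(x, b)\<close> with \<open>b\<close> of length \<open>m\<close>, not just on the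
  set defined by it.\<close>

definition nondegenerate ::
  "('f, 'r, 'a) fo_struct \<Rightarrow> nat \<Rightarrow> nat \<Rightarrow> ('f, 'r) fm \<Rightarrow> (nat \<Rightarrow> 'a) \<Rightarrow> bool" where
  "nondegenerate M k m \<phi> b \<longleftrightarrow>
     (\<exists>x \<in> solutions M k \<phi> b. inj_on x {..<k} \<and> x ` {..<k} \<inter> b ` {..<m} = {})"

text \<open>A (partial) \<open>n\<close>-type without parameters, with respect to the complete theory of \<open>M\<close>.\<close>

definition is_type ::
  "('f, 'r) language \<Rightarrow> ('f, 'r, 'a) fo_struct \<Rightarrow> nat \<Rightarrow> ('f, 'r) fm set \<Rightarrow> bool" where
  "is_type L M n p \<longleftrightarrow> (\<forall>\<phi>\<in>p. formula L n \<phi>) \<and>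
     (\<forall>q \<subseteq> p. finite q \<longrightarrow> (\<exists>x \<in> {..<n} \<rightarrow>\<^sub>E univ M. \<forall>\<phi>\<in>q. sat M x \<phi>))"

definition omits :: "('f, 'r, 'a) fo_struct \<Rightarrow> nat \<Rightarrow> ('f, 'r) fm set \<Rightarrow> bool" where
  "omits M n p \<longleftrightarrow> \<not> (\<exists>x \<in> {..<n} \<rightarrow>\<^sub>E univ M. \<forall>\<phi>\<in>p. sat M x \<phi>)"

text \<open>The two disjuncts say that the universal closure of \<open>\<phi> \<longrightarrow> \<psi>\<close>, respectively
  \<open>\<phi> \<longrightarrow> \<not> \<psi>\<close>, belongs to (equivalently, follows from) the complete theory of \<open>M\<close>.\<close>

definition complete_formula ::
  "('f, 'r) language \<Rightarrow> ('f, 'r, 'a) fo_struct \<Rightarrow> nat \<Rightarrow> ('f, 'r) fm \<Rightarrow> bool" where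
  "complete_formula L M n \<phi> \<longleftrightarrow> formula L n \<phi> \<and>
     (\<exists>x \<in> {..<n} \<rightarrow>\<^sub>E univ M. sat M x \<phi>) \<and>
     (\<forall>\<psi>. formula L n \<psi> \<longrightarrow>
        (\<forall>x \<in> {..<n} \<rightarrow>\<^sub>E univ M. sat M x \<phi> \<longrightarrow> sat M x \<psi>) \<or>
        (\<forall>x \<in> {..<n} \<rightarrow>\<^sub>E univ M. sat M x \<phi> \<longrightarrow> \<not> sat M x \<psi>))"

definition atomic :: "('f, 'r) language \<Rightarrow> ('f, 'r, 'a) fo_struct \<Rightarrow> bool" where
  "atomic L M \<longleftrightarrow>
     (\<forall>n. \<forall>x \<in> {..<n} \<rightarrow>\<^sub>E univ M. \<exists>\<phi>. complete_formula L M n \<phi> \<and> sat M x \<phi>)"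

section \<open>Asymptotic similarity\<close>

type_synonym cantor = "nat \<Rightarrow> bool"

definition similar_mod :: "nat \<Rightarrow> nat \<Rightarrow> (nat \<Rightarrow> cantor) \<Rightarrow> (nat \<Rightarrow> cantor) \<Rightarrow> bool" where
  "similar_mod k l \<eta> \<tau> \<longleftrightarrow> inj_on \<eta> {..<k} \<and> inj_on \<tau> {..<k} \<and>
     inj_on (\<lambda>j. restrict (\<eta> j) {..<l}) {..<k} \<and>
     (\<forall>j<k. restrict (\<eta> j) {..<l} = restrict (\<tau> j) {..<l})"

definition asymptotically_similar ::
  "('f, 'r) language \<Rightarrow> ('f, 'r, 'a) fo_struct \<Rightarrow> (cantor \<Rightarrow> 'a) \<Rightarrow> bool" where
  "asymptotically_similar L N a \<longleftrightarrow>
     (\<forall>k \<theta>. formula L k \<theta> \<longrightarrow>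
        (\<exists>l0. \<forall>l\<ge>l0. \<forall>\<eta> \<tau>. similar_mod k l \<eta> \<tau> \<longrightarrow>
           (sat N (\<lambda>j. a (\<eta> j)) \<theta> \<longleftrightarrow> sat N (\<lambda>j. a (\<tau> j)) \<theta>)))"

section \<open>Topology and measure\<close>

inductive_set boolean_combinations :: "'a topology \<Rightarrow> 'a set set" for X :: "'a topology" where
  "openin X U \<Longrightarrow> U \<in> boolean_combinations X"
| "A \<in> boolean_combinations X \<Longrightarrow> topspace X - A \<in> boolean_combinations X"
| "A \<in> boolean_combinations X \<Longrightarrow> B \<in> boolean_combinations X \<Longrightarrow> A \<union> B \<in> boolean_combinations X"

definition cylinder :: "bool list \<Rightarrow> cantor set" where
  "cylinder s = {\<eta>. \<forall>j<length s. \<eta> j = s ! j}"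

text \<open>
  The library topology on \<^typ>\<open>cantor \<times> nat\<close> is the one with basic open sets
  \<open>cylinder s \<times> {i}\<close>:
\<close>

instance bool :: second_countable_topology
proof
  have "generate_topology UNIV A" for A :: "bool set"
    by (rule generate_topology.Basis) (rule UNIV_I)
  then have "open = generate_topology (UNIV :: bool set set)"
    by (intro ext) (simp add: Topological_Spaces.open_discrete)
  moreover have "countable (UNIV :: bool set set)"
    by (rule countable_finite) (rule finite)
  ultimately show "\<exists>B :: bool set set. countable B \<and> open = generate_topology B"
    by blast
qed

lemma open_cylinder: "open (cylinder s)"
proof -
  have "open {\<eta>. \<forall>j\<in>{..<length s}. (\<eta> j :: bool) \<in> {s ! j}}"
    by (rule product_topology_basis'[where x = "\<lambda>j. j"]) (auto intro: Topological_Spaces.open_discrete)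
  moreover have "{\<eta>. \<forall>j\<in>{..<length s}. (\<eta> j :: bool) \<in> {s ! j}} = cylinder s"
    by (auto simp: cylinder_def)
  ultimately show ?thesis by simp
qed

lemma cylinder_basis: "topological_basis (range (\<lambda>(s, i). cylinder s \<times> {i :: nat}))"
proof (rule topological_basisI)
  fix B :: "(cantor \<times> nat) set"
  assume "B \<in> range (\<lambda>(s, i). cylinder s \<times> {i})"
  then show "open B"
    by (auto intro!: open_Times open_cylinder simp: Topological_Spaces.open_discrete)
next
  fix W :: "(cantor \<times> nat) set" and x
  assume W: "open W" and "x \<in> W"
  obtain \<eta> i where x: "x = (\<eta>, i)" by (cases x)
  obtain A B where AB: "open A" "\<eta> \<in> A" "i \<in> B" "A \<times> B \<subseteq> W"
    by (rule open_prod_elim[OF W \<open>x \<in> W\<close>]) (metis mem_Sigma_iff x)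
  have "openin (product_topology (\<lambda>_. euclidean) UNIV) A"
    using \<open>open A\<close> by (simp add: open_fun_def)
  from product_topology_open_contains_basis[OF this \<open>\<eta> \<in> A\<close>]
  obtain X where X: "\<eta> \<in> Pi\<^sub>E UNIV X" "finite {j. X j \<noteq> UNIV}" "Pi\<^sub>E UNIV X \<subseteq> A"
    by auto
  obtain n where n: "{j. X j \<noteq> UNIV} \<subseteq> {..<n}"
    using finite_nat_iff_bounded X(2) by blast
  define s where "s = map \<eta> [0..<n]"
  have "cylinder s \<subseteq> Pi\<^sub>E UNIV X"
  proof
    fix \<tau> assume \<tau>: "\<tau> \<in> cylinder s"
    have "\<tau> j \<in> X j" for j
    proof (cases "j < n")
      case True
      then have "\<tau> j = \<eta> j" using \<tau> by (auto simp: cylinder_def s_def)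
      then show ?thesis using X(1) by (auto simp: PiE_iff)
    next
      case False
      then have "X j = UNIV" using n by auto
      then show ?thesis by simp
    qed
    then show "\<tau> \<in> Pi\<^sub>E UNIV X" by (auto simp: PiE_iff)
  qed
  then have "cylinder s \<times> {i} \<subseteq> W" using X(3) AB by blast
  moreover have "x \<in> cylinder s \<times> {i}" by (auto simp: x cylinder_def s_def)
  ultimately show "\<exists>B\<in>range (\<lambda>(s, i). cylinder s \<times> {i}). x \<in> B \<and> B \<subseteq> W"
    by (intro bexI[of _ "cylinder s \<times> {i}"]) auto
qed

text \<open>The fair-coin measure times the measure giving \<open>i\<close> mass \<open>(1/2)^(i+1)\<close>.  By
  \<open>sets_mu\<close> and \<open>emeasure_mu\<close> this is the Borel measure determined by its values
  on basic open sets.\<close>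

definition mu :: "(cantor \<times> nat) measure" where
  "mu = (\<Pi>\<^sub>M j\<in>UNIV. measure_pmf (pmf_of_set (UNIV :: bool set)))
          \<Otimes>\<^sub>M measure_pmf (geometric_pmf (1/2))"

lemma sets_mu: "sets mu = sets borel"
proof -
  have b: "sets (measure_pmf p) = sets borel" for p :: "'a::{countable, discrete_topology} pmf"
    by (auto intro: borel_open Topological_Spaces.open_discrete)
  have "sets mu = sets ((\<Pi>\<^sub>M j\<in>(UNIV::nat set). (borel :: bool measure)) \<Otimes>\<^sub>M (borel :: nat measure))"
    unfolding mu_def by (intro sets_pair_measure_cong sets_PiM_cong refl b)
  also have "\<dots> = sets ((borel :: cantor measure) \<Otimes>\<^sub>M (borel :: nat measure))"
    by (intro sets_pair_measure_cong sets_PiM_equal_borel refl)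
  finally show ?thesis unfolding borel_prod .
qed

lemma emeasure_mu: "emeasure mu (cylinder s \<times> {i}) = (1 / 2) ^ (length s + i + 1)"
proof -
  let ?B = "measure_pmf (pmf_of_set (UNIV :: bool set))"
  interpret P: product_prob_space "\<lambda>_::nat. ?B" UNIV by unfold_locales
  have cyl: "cylinder s = {\<eta> \<in> space (\<Pi>\<^sub>M j\<in>(UNIV::nat set). ?B). \<forall>j\<in>{..<length s}. \<eta> j \<in> {s ! j}}"
    by (auto simp: cylinder_def space_PiM)
  have half: "ennreal (1 / 2) = 1 / 2"
    by (metis divide_ennreal ennreal_1 ennreal_numeral zero_le_numeral zero_le_one zero_less_numeral)
  have one: "emeasure ?B {b} = 1 / 2" for b
    by (simp add: emeasure_pmf_single half[symmetric])
  have "emeasure (\<Pi>\<^sub>M j\<in>(UNIV::nat set). ?B) (cylinder s) = (\<Prod>j\<in>{..<length s}. emeasure ?B {s ! j})"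
    unfolding cyl by (rule P.emeasure_PiM_Collect) auto
  also have "\<dots> = (1 / 2) ^ length s" by (simp add: one)
  finally have c: "emeasure (\<Pi>\<^sub>M j\<in>(UNIV::nat set). ?B) (cylinder s) = (1 / 2) ^ length s" .
  have "emeasure (measure_pmf (geometric_pmf (1/2))) {i} = ennreal ((1 / 2) ^ (i + 1))"
    by (simp add: emeasure_pmf_single)
  also have "\<dots> = (1 / 2) ^ (i + 1)"
    unfolding half[symmetric] by (rule ennreal_power[symmetric]) simp
  finally have g: "emeasure (measure_pmf (geometric_pmf (1/2))) {i} = (1 / 2) ^ (i + 1)" .
  have "sets (\<Pi>\<^sub>M j\<in>(UNIV::nat set). ?B) = sets (\<Pi>\<^sub>M j\<in>(UNIV::nat set). (borel :: bool measure))"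
    by (intro sets_PiM_cong refl) (auto intro: borel_open Topological_Spaces.open_discrete)
  also have "\<dots> = sets borel" by (rule sets_PiM_equal_borel)
  finally have "cylinder s \<in> sets (\<Pi>\<^sub>M j\<in>(UNIV::nat set). ?B)"
    using borel_open[OF open_cylinder] by metis
  then have "emeasure mu (cylinder s \<times> {i}) = (1 / 2) ^ length s * (1 / 2) ^ (i + 1)"
    unfolding mu_def by (subst measure_pmf.emeasure_pair_measure_Times) (auto simp: c g)
  then show ?thesis by (simp add: power_add ac_simps)
qed

text \<open>For an indexing \<open>a\<close> of a set by \<open>cantor \<times> nat\<close>, the set of \<open>k\<close>-tuples of indices
  corresponding to a set \<open>D\<close> of \<open>k\<close>-tuples of elements.\<close>

definition index_set ::
  "(cantor \<Rightarrow> nat \<Rightarrow> 'a) \<Rightarrow> nat \<Rightarrow> (nat \<Rightarrow> 'a) set \<Rightarrow> (nat \<Rightarrow> cantor \<times> nat) set" where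
  "index_set a k D = {p \<in> {..<k} \<rightarrow>\<^sub>E UNIV. (\<lambda>j\<in>{..<k}. a (fst (p j)) (snd (p j))) \<in> D}"

end

theory Submission
  imports Defs
begin

text \<open>
  Trivial definable closure makes every formula satisfied by a tuple of distinct elements satisfied
  by infinitely many variations of any single entry.  Hence the entries can be doubled one at a
  time so that every choice of copies satisfies the same prescribed finite set of formulas as the
  original tuple.  Iterating this along \<open>2^<\<omega>\<close>, while adding columns that contain witnesses for
  existential formulas, yields an injective map \<open>c\<close> from the finitely supported points of
  \<open>2^\<omega> \<times> \<omega>\<close> into \<open>M\<close> such that for each formula \<open>\<theta>\<close> and each tuple \<open>e\<close> of points of
  \<open>2^\<omega> \<times> \<omega>\<close> the truth value of \<open>\<theta>\<close> in \<open>M\<close> at the images of the truncations of \<open>e\<close> to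
  \<open>l\<close> bits is eventually constant in \<open>l\<close>, from some \<open>l\<close> on that is determined by \<open>\<theta>\<close>, the
  columns of \<open>e\<close> and the bits separating its entries.  The eventual truth values are the
  satisfaction relation of the model \<open>N\<close>.  A type omitted by \<open>M\<close> stays omitted because at each
  stage a formula of the type falsified by the current approximation of a tuple is put among the
  formulas to be preserved; atomicity is the omission of the types \<open>{\<not> \<phi> | \<phi> complete}\<close>.
\<close>

section \<open>Syntax\<close>

lemma finite_fv_tm: "finite (fv_tm t)"
  by (induction t) auto

lemma finite_fv: "finite (fv \<phi>)"
  by (induction \<phi>) (auto simp: finite_fv_tm)

lemma val_cong: "(\<And>n. n \<in> fv_tm t \<Longrightarrow> e n = e' n) \<Longrightarrow> val M e t = val M e' t"
  by (induction t) (auto intro!: arg_cong[where f = "fn M _"] map_cong)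

lemma sat_cong: "(\<And>n. n \<in> fv \<phi> \<Longrightarrow> e n = e' n) \<Longrightarrow> sat M e \<phi> \<longleftrightarrow> sat M e' \<phi>"
proof (induction \<phi> arbitrary: e e')
  case (Eq s t)
  then show ?case using val_cong[of s e e' M] val_cong[of t e e' M] by simp
next
  case (Rel r ts)
  then have "map (val M e) ts = map (val M e') ts"
    by (intro map_cong val_cong refl) auto
  then show ?case by (simp only: sat.simps)
next
  case (Neg \<phi>)
  have "sat M e \<phi> \<longleftrightarrow> sat M e' \<phi>" using Neg.prems by (intro Neg.IH) simp
  then show ?case by simp
next
  case (Conj \<phi> \<psi>)
  have "sat M e \<phi> \<longleftrightarrow> sat M e' \<phi>" "sat M e \<psi> \<longleftrightarrow> sat M e' \<psi>"
    using Conj.prems by (rule Conj.IH; simp)+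
  then show ?case by simp
next
  case (Exi n \<phi>)
  have "sat M (e(n := x)) \<phi> \<longleftrightarrow> sat M (e'(n := x)) \<phi>" for x
    using Exi.prems by (intro Exi.IH) auto
  then show ?case by simp
qed

section \<open>Renaming of free variables\<close>

fun ren_tm :: "(nat \<Rightarrow> nat) \<Rightarrow> 'f tm \<Rightarrow> 'f tm" where
  "ren_tm v (Var n) = Var (v n)"
| "ren_tm v (App f ts) = App f (map (ren_tm v) ts)"

text \<open>A bound variable moves to an index to which no free variable of the body is sent. This
  prevents capture, so \<open>sat_ren\<close> holds for every \<open>v\<close>, injective or
  not.\<close>

fun ren :: "(nat \<Rightarrow> nat) \<Rightarrow> ('f, 'r) fm \<Rightarrow> ('f, 'r) fm" where
  "ren v (Eq s t) = Eq (ren_tm v s) (ren_tm v t)"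
| "ren v (Rel r ts) = Rel r (map (ren_tm v) ts)"
| "ren v (Neg \<phi>) = Neg (ren v \<phi>)"
| "ren v (Conj \<phi> \<psi>) = Conj (ren v \<phi>) (ren v \<psi>)"
| "ren v (Exi n \<phi>) = (let n' = LEAST k. k \<notin> v ` fv \<phi> in Exi n' (ren (v(n := n')) \<phi>))"

lemma Least_notin_finite: "finite A \<Longrightarrow> (LEAST k::nat. k \<notin> A) \<notin> A"
  by (rule LeastI_ex) (use ex_new_if_finite infinite_UNIV_nat in blast)

lemma wf_ren_tm: "wf_tm L t \<Longrightarrow> wf_tm L (ren_tm v t)"
  by (induction t) auto

lemma fv_ren_tm: "fv_tm (ren_tm v t) = v ` fv_tm t"
  by (induction t) auto

lemma val_ren_tm: "val M e (ren_tm v t) = val M (\<lambda>n. e (v n)) t"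
  by (induction t) (auto intro!: arg_cong[where f = "fn M _"])

lemma wf_ren: "wf_fm L \<phi> \<Longrightarrow> wf_fm L (ren v \<phi>)"
  by (induction \<phi> arbitrary: v) (auto simp: wf_ren_tm Let_def)

lemma fv_ren: "fv (ren v \<phi>) \<subseteq> v ` fv \<phi>"
proof (induction \<phi> arbitrary: v)
  case (Exi n \<phi>)
  define n' where "n' = (LEAST k. k \<notin> v ` fv \<phi>)"
  show ?case
    using Exi.IH[of "v(n := n')"] unfolding ren.simps Let_def n'_def[symmetric]
    by (fastforce simp del: fun_upd_apply simp: fun_upd_def split: if_splits)
next
  case (Conj \<phi> \<psi>)
  then show ?case unfolding ren.simps fv.simps image_Un by (rule Un_mono)
qed (auto simp: fv_ren_tm)

lemma sat_ren: "sat M e (ren v \<phi>) \<longleftrightarrow> sat M (\<lambda>n. e (v n)) \<phi>"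
proof (induction \<phi> arbitrary: v e)
  case (Exi n \<phi>)
  define n' where "n' = (LEAST k. k \<notin> v ` fv \<phi>)"
  have n': "n' \<notin> v ` fv \<phi>"
    unfolding n'_def by (intro Least_notin_finite finite_imageI finite_fv)
  have "sat M (e(n' := x)) (ren (v(n := n')) \<phi>) \<longleftrightarrow> sat M ((\<lambda>n. e (v n))(n := x)) \<phi>" for x
    unfolding Exi.IH using n' by (intro sat_cong) auto
  then show ?case by (simp add: Let_def n'_def[symmetric])
qed (auto simp: val_ren_tm comp_def intro!: arg_cong[where f = "rl M _"])

lemma ex_conjunction:
  fixes S :: "('f, 'r) fm set"
  assumes "finite S" "\<forall>\<psi>\<in>S. wf_fm L \<psi>" "univ M \<noteq> {}"
  shows "\<exists>\<phi>. wf_fm L \<phi> \<and> fv \<phi> \<subseteq> (\<Union>\<psi>\<in>S. fv \<psi>) \<and> (\<forall>e. sat M e \<phi> \<longleftrightarrow> (\<forall>\<psi>\<in>S. sat M e \<psi>))"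
  using assms(1,2)
proof (induction S rule: finite_induct)
  case empty
  \<comment> \<open>The empty conjunction must not have free variables: it is \<exists>x. x = x,
    which is true because the universe is non-empty.\<close>
  show ?case
    using \<open>univ M \<noteq> {}\<close> by (intro exI[of _ "Exi 0 (Eq (Var 0) (Var 0))"]) auto
next
  case (insert \<psi> S)
  then obtain \<phi> where "wf_fm L \<phi>" "fv \<phi> \<subseteq> (\<Union>\<psi>\<in>S. fv \<psi>)" "\<forall>e. sat M e \<phi> \<longleftrightarrow> (\<forall>\<psi>\<in>S. sat M e \<psi>)"
    by auto
  then show ?case
    using insert.prems by (intro exI[of _ "Conj \<psi> \<phi>"]) auto
qed

section \<open>Countability of the set of formulas of a countable language\<close>

instance tm :: (countable) countable
  by countable_datatype

instance fm :: (countable, countable) countable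
  by countable_datatype

lemma set_tm_wf: "wf_tm L t \<Longrightarrow> set_tm t \<subseteq> funs L"
  by (induction t) auto

lemma set_fm_wf: "wf_fm L \<phi> \<Longrightarrow> set1_fm \<phi> \<subseteq> funs L \<and> set2_fm \<phi> \<subseteq> rels L"
  by (induction \<phi>) (use set_tm_wf in fastforce)+

text \<open>The types of symbols may be uncountable, but a well-formed formula contains only symbols
  of \<open>L\<close>. Replacing these by their numbers embeds the well-formed formulas into the
  countable type of formulas over \<open>nat\<close>.\<close>

lemma countable_wf_fm:
  assumes "countable_language L"
  shows "countable {\<phi>. wf_fm L \<phi>}"
proof -
  define g where "g = map_fm (to_nat_on (funs L)) (to_nat_on (rels L))"
  have inj: "inj_on (to_nat_on (funs L)) (funs L)" "inj_on (to_nat_on (rels L)) (rels L)"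
    using assms by (auto simp: countable_language_def)
  have "inj_on g {\<phi>. wf_fm L \<phi>}"
  proof (rule inj_onI)
    fix \<phi> \<psi> assume wf: "\<phi> \<in> {\<phi>. wf_fm L \<phi>}" "\<psi> \<in> {\<phi>. wf_fm L \<phi>}" and eq: "g \<phi> = g \<psi>"
    have sub: "set1_fm \<phi> \<subseteq> funs L" "set2_fm \<phi> \<subseteq> rels L" "set1_fm \<psi> \<subseteq> funs L" "set2_fm \<psi> \<subseteq> rels L"
      using wf set_fm_wf[of L] by auto
    show "\<phi> = \<psi>"
      by (rule fm.inj_map_strong[OF _ _ eq[unfolded g_def]])
        (use sub inj in \<open>auto dest: inj_onD\<close>)
  qed
  then show ?thesis by (rule countableI')
qed

section \<open>Duplicating elements\<close>

locale trivial_dcl_struct =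
  fixes L :: "('f, 'r) language" and M :: "('f, 'r, 'a) fo_struct"
  assumes struct: "is_struct L M" and dcl: "trivial_dcl L M"
begin

lemma univ_nonempty: "univ M \<noteq> {}"
  using struct by (simp add: is_struct_def)

text \<open>This is triviality of \<open>dcl\<close> expressed through assignments: the parameters
  are the values of \<open>e\<close> at the free variables other than \<open>j\<close>. If
  \<open>b\<close> were none of them, it would be definable over
  \<open>univ M - {b}\<close>.\<close>

lemma unique_solution:
  assumes wf: "wf_fm L \<phi>" and e: "range e \<subseteq> univ M" and b: "b \<in> univ M"
    and uniq: "\<And>c. c \<in> univ M \<Longrightarrow> sat M (e(j := c)) \<phi> \<longleftrightarrow> c = b"
  shows "b \<in> e ` (fv \<phi> - {j})"
proof (rule ccontr)
  assume nb: "b \<notin> e ` (fv \<phi> - {j})"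
  have triv: "dcl L M A = A" if "A \<subseteq> univ M" for A
    using dcl that by (simp add: trivial_dcl_def)
  \<comment> \<open>A default parameter for the indices below \<open>m\<close> that carry no value
    of \<open>e\<close>; it must avoid \<open>b\<close>. It exists because in a one-element
    structure x = x would define \<open>b\<close> without parameters.\<close>
  obtain d where d: "d \<in> univ M" "d \<noteq> b"
  proof (rule ccontr)
    assume "\<not> thesis"
    with that b have "univ M = {b}" by auto
    then have "b \<in> dcl L M {}"
      by (auto simp: dcl_def formula_def intro!: exI[of _ 0] exI[of _ "Eq (Var 0) (Var 0)"])
    with triv[of "{}"] show False by simp
  qed
  obtain m where m: "fv \<phi> \<subseteq> {..<m}"
    using finite_fv finite_nat_iff_bounded by blast
  define a where "a = (\<lambda>n\<in>{..<m}. if n \<in> fv \<phi> - {j} then e n else d)"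
  have a: "a \<in> {..<m} \<rightarrow>\<^sub>E (univ M - {b})"
  proof (unfold a_def, rule restrict_PiE_iff[THEN iffD2], rule ballI)
    fix n show "(if n \<in> fv \<phi> - {j} then e n else d) \<in> univ M - {b}"
      using range_subsetD[OF e, of n] d nb by (cases "n \<in> fv \<phi> - {j}") auto
  qed
  \<comment> \<open>The unknown goes to variable \<open>0\<close> and the parameter
    \<open>a n\<close> to variable \<open>1 + n\<close>, the layout of
    \<open>join 1\<close>.\<close>
  define v where "v = (\<lambda>n. if n = j then 0 else Suc n)"
  have "fv (ren v \<phi>) \<subseteq> {..<1 + m}"
    using fv_ren[of v \<phi>] m by (fastforce simp: v_def split: if_splits)
  then have "formula L (1 + m) (ren v \<phi>)"
    using wf by (simp add: formula_def wf_ren)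
  moreover have "sat M (join 1 (\<lambda>_. c) a) (ren v \<phi>) \<longleftrightarrow> c = b" if "c \<in> univ M" for c
  proof -
    have "sat M (\<lambda>n. join 1 (\<lambda>_. c) a (v n)) \<phi> \<longleftrightarrow> sat M (e(j := c)) \<phi>"
      using m by (intro sat_cong) (auto simp: join_def v_def a_def)
    with uniq[OF that] show ?thesis by (simp add: sat_ren)
  qed
  ultimately have "b \<in> dcl L M (univ M - {b})"
    using b a by (auto simp: dcl_def)
  with triv[of "univ M - {b}"] show False by auto
qed

text \<open>Triviality passes from definable to algebraic closure. Each induction step excludes one
  element of \<open>X\<close> by an inequation with a new parameter; unless \<open>b\<close> is that
  element, it still has to be an old parameter or in the rest of \<open>X\<close>.\<close>

lemma finitely_many_solutions:
  assumes "finite X" "X \<subseteq> univ M" "wf_fm L \<phi>" "range e \<subseteq> univ M" "b \<in> univ M"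
    "sat M (e(j := b)) \<phi>"
    "\<And>c. c \<in> univ M \<Longrightarrow> sat M (e(j := c)) \<phi> \<Longrightarrow> c \<in> insert b X"
  shows "b \<in> e ` (fv \<phi> - {j}) \<union> X"
  using assms
proof (induction X arbitrary: \<phi> e rule: finite_induct)
  case empty
  have "b \<in> e ` (fv \<phi> - {j})"
  proof (rule unique_solution)
    show "sat M (e(j := c)) \<phi> \<longleftrightarrow> c = b" if "c \<in> univ M" for c
      using empty.prems(5) empty.prems(6)[OF that] by blast
  qed (use empty.prems in blast)+
  then show ?case by simp
next
  case (insert x X)
  show ?case
  proof (rule ccontr)
    assume nb: "b \<notin> e ` (fv \<phi> - {j}) \<union> insert x X"
    obtain z where z: "z \<notin> insert j (fv \<phi>)"
      using ex_new_if_finite[OF infinite_UNIV_nat, of "insert j (fv \<phi>)"] finite_fv[of \<phi>] by auto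
    define \<phi>' where "\<phi>' = Conj \<phi> (Neg (Eq (Var j) (Var z)))"
    define e' where "e' = e(z := x)"
    have sat': "sat M (e'(j := c)) \<phi>' \<longleftrightarrow> sat M (e(j := c)) \<phi> \<and> c \<noteq> x" for c
    proof -
      have "sat M (e'(j := c)) \<phi> \<longleftrightarrow> sat M (e(j := c)) \<phi>"
        using z by (intro sat_cong) (auto simp: e'_def)
      then show ?thesis using z by (auto simp: \<phi>'_def e'_def)
    qed
    have "b \<in> e' ` (fv \<phi>' - {j}) \<union> X"
    proof (rule insert.IH)
      show "X \<subseteq> univ M" "wf_fm L \<phi>'" "range e' \<subseteq> univ M" "b \<in> univ M"
        using insert.prems by (auto simp: \<phi>'_def e'_def)
      show "sat M (e'(j := b)) \<phi>'"
        using insert.prems(5) nb unfolding sat' by blast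
      show "c \<in> insert b X" if "c \<in> univ M" "sat M (e'(j := c)) \<phi>'" for c
        using insert.prems(6)[OF that(1)] that(2) unfolding sat' by blast
    qed
    then show False using nb by (auto simp: \<phi>'_def e'_def split: if_splits)
  qed
qed

text \<open>The behaviour of \<open>c\<close> on \<open>I\<close> with respect to \<open>F\<close>
  is described by one formula, with \<open>c i\<close> as unknown and the other values as
  parameters. With only finitely many solutions, \<open>c i\<close> would equal one of these
  parameters, which injectivity of \<open>c\<close> forbids.\<close>

lemma infinitely_many_similar:
  assumes I: "finite I" "inj_on c I" "i \<in> I" and c: "range c \<subseteq> univ M"
    and F: "finite F" "\<And>\<theta>. \<theta> \<in> F \<Longrightarrow> wf_fm L \<theta>"
  shows "infinite {d \<in> univ M. \<forall>\<theta>\<in>F. \<forall>v. v ` fv \<theta> \<subseteq> I \<longrightarrow>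
    (sat M (\<lambda>n. (c(i := d)) (v n)) \<theta> \<longleftrightarrow> sat M (\<lambda>n. c (v n)) \<theta>)}" (is "infinite ?D")
proof
  assume fin: "finite ?D"
  obtain h :: "'b \<Rightarrow> nat" where h: "inj_on h I"
    using finite_imp_inj_to_nat_seg[OF I(1)] by blast
  define e where "e = c \<circ> inv_into I h"
  have eh: "(e(h i := d)) (h k) = (c(i := d)) k" if "k \<in> I" for k d
    using h that I(3) by (auto simp: e_def dest: inj_onD)
  \<comment> \<open>The diagram of \<open>c\<close>: every formula of \<open>F\<close> in every
    placing of its variables on \<open>I\<close>, negated where it fails. Placings are restricted to
    the free variables so that there are finitely many. The injection \<open>h\<close> turns
    elements of \<open>I\<close> into variables.\<close>
  define S where "S = (\<lambda>(\<theta>, v). if sat M (\<lambda>n. c (v n)) \<theta> then ren (\<lambda>n. h (v n)) \<theta> else Neg (ren (\<lambda>n. h (v n)) \<theta>)) `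
    (SIGMA \<theta>:F. fv \<theta> \<rightarrow>\<^sub>E I)"
  have "finite S"
    unfolding S_def using F I(1) by (intro finite_imageI finite_SigmaI finite_PiE finite_fv) auto
  moreover have "\<forall>\<psi>\<in>S. wf_fm L \<psi>"
    using F(2) by (auto simp: S_def wf_ren)
  ultimately obtain \<phi> where \<phi>: "wf_fm L \<phi>" "fv \<phi> \<subseteq> (\<Union>\<psi>\<in>S. fv \<psi>)"
    "\<And>e. sat M e \<phi> \<longleftrightarrow> (\<forall>\<psi>\<in>S. sat M e \<psi>)"
    using ex_conjunction[OF _ _ univ_nonempty] by metis
  have "fv \<psi> \<subseteq> h ` I" if "\<psi> \<in> S" for \<psi>
  proof -
    obtain x where x: "\<psi> = (\<lambda>(\<theta>, v). if sat M (\<lambda>n. c (v n)) \<theta> then ren (\<lambda>n. h (v n)) \<theta>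
        else Neg (ren (\<lambda>n. h (v n)) \<theta>)) x" "x \<in> (SIGMA \<theta>:F. fv \<theta> \<rightarrow>\<^sub>E I)"
      using \<open>\<psi> \<in> S\<close> unfolding S_def by (rule imageE)
    obtain \<theta> v where "x = (\<theta>, v)" by (cases x)
    with x have v: "v \<in> fv \<theta> \<rightarrow>\<^sub>E I"
      and "\<psi> = (if sat M (\<lambda>n. c (v n)) \<theta> then ren (\<lambda>n. h (v n)) \<theta> else Neg (ren (\<lambda>n. h (v n)) \<theta>))"
      by auto
    then have "\<psi> = ren (\<lambda>n. h (v n)) \<theta> \<or> \<psi> = Neg (ren (\<lambda>n. h (v n)) \<theta>)"
      by (simp split: if_splits)
    then have "fv \<psi> \<subseteq> (\<lambda>n. h (v n)) ` fv \<theta>" using fv_ren[of "\<lambda>n. h (v n)" \<theta>] by auto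
    then show ?thesis using v by auto
  qed
  with \<phi>(2) have fv\<phi>: "fv \<phi> \<subseteq> h ` I" by blast
  have sat\<phi>: "sat M (e(h i := d)) \<phi> \<longleftrightarrow> d \<in> ?D" if d: "d \<in> univ M" for d
  proof -
    have ren: "sat M (e(h i := d)) (ren (\<lambda>n. h (v n)) \<theta>) \<longleftrightarrow> sat M (\<lambda>n. (c(i := d)) (v n)) \<theta>"
      if "v ` fv \<theta> \<subseteq> I" for \<theta> v
      unfolding sat_ren
    proof (rule sat_cong)
      fix n assume "n \<in> fv \<theta>"
      then have "v n \<in> I" using that by auto
      then show "(e(h i := d)) (h (v n)) = (c(i := d)) (v n)" by (rule eh)
    qed
    have "sat M (e(h i := d)) \<phi> \<longleftrightarrow> (\<forall>\<theta>\<in>F. \<forall>v \<in> fv \<theta> \<rightarrow>\<^sub>E I.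
        sat M (\<lambda>n. (c(i := d)) (v n)) \<theta> \<longleftrightarrow> sat M (\<lambda>n. c (v n)) \<theta>)"
      unfolding \<phi>(3) by (auto simp: S_def ren image_subset_iff PiE_iff split: if_splits)
    also have "\<dots> \<longleftrightarrow> d \<in> ?D"
    proof safe
      fix \<theta> v assume *: "\<forall>\<theta>\<in>F. \<forall>v \<in> fv \<theta> \<rightarrow>\<^sub>E I. sat M (\<lambda>n. (c(i := d)) (v n)) \<theta> \<longleftrightarrow> sat M (\<lambda>n. c (v n)) \<theta>"
        and "\<theta> \<in> F" "v ` fv \<theta> \<subseteq> I"
      then have "sat M (\<lambda>n. (c(i := d)) (restrict v (fv \<theta>) n)) \<theta> \<longleftrightarrow> sat M (\<lambda>n. c (restrict v (fv \<theta>) n)) \<theta>"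
        by (metis image_subset_iff restrict_PiE_iff)
      moreover have "sat M (\<lambda>n. (c(i := d)) (restrict v (fv \<theta>) n)) \<theta> \<longleftrightarrow> sat M (\<lambda>n. (c(i := d)) (v n)) \<theta>"
        "sat M (\<lambda>n. c (restrict v (fv \<theta>) n)) \<theta> \<longleftrightarrow> sat M (\<lambda>n. c (v n)) \<theta>"
        by (auto intro!: sat_cong)
      ultimately show "sat M (\<lambda>n. (c(i := d)) (v n)) \<theta> \<Longrightarrow> sat M (\<lambda>n. c (v n)) \<theta>"
        "sat M (\<lambda>n. c (v n)) \<theta> \<Longrightarrow> sat M (\<lambda>n. (c(i := d)) (v n)) \<theta>" by blast+
    qed (use d in \<open>auto simp: PiE_iff image_subset_iff\<close>)
    finally show ?thesis .
  qed
  have ci: "c i \<in> univ M" using c by auto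
  then have ciD: "c i \<in> ?D" by (simp only: mem_Collect_eq fun_upd_triv) simp
  \<comment> \<open>The other elements of \<open>?D\<close> serve as the finite exceptional set. As
    \<open>c i\<close> is not in it, \<open>c i\<close> has to be the value of a parameter.\<close>
  have "c i \<in> e ` (fv \<phi> - {h i}) \<union> (?D - {c i})"
  proof (rule finitely_many_solutions)
    show "finite (?D - {c i})" using fin by blast
    show "range e \<subseteq> univ M" using c by (auto simp: e_def)
    show "sat M (e(h i := c i)) \<phi>" using sat\<phi>[OF ci] ciD by blast
    show "d \<in> insert (c i) (?D - {c i})" if "d \<in> univ M" "sat M (e(h i := d)) \<phi>" for d
      using that sat\<phi>[of d] by blast
  qed (use \<phi> ci in auto)
  then obtain k where "k \<in> I" "k \<noteq> i" "c i = e (h k)"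
    using fv\<phi> by blast
  moreover have "e (h k) = c k" using \<open>k \<in> I\<close> h by (simp add: e_def)
  ultimately show False using I(2,3) by (auto dest: inj_onD)
qed

text \<open>The points of \<open>J - K\<close> are added one at a time. The value at a new point
  \<open>j\<close> is one of the infinitely many elements that can replace the value at
  \<open>r j\<close>, chosen different from all values used so far. Injectivity of \<open>r\<close>
  on a tuple says that it never contains two copies of one point.\<close>

lemma duplicate:
  assumes J: "finite J" and K: "K \<subseteq> J" and r: "r ` J \<subseteq> K" "\<And>k. k \<in> K \<Longrightarrow> r k = k"
    and c: "inj_on c K" "range c \<subseteq> univ M"
    and F: "finite F" "\<And>\<theta>. \<theta> \<in> F \<Longrightarrow> wf_fm L \<theta>"
  shows "\<exists>c'. inj_on c' J \<and> range c' \<subseteq> univ M \<and> (\<forall>k\<in>K. c' k = c k) \<and>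
    (\<forall>\<theta>\<in>F. \<forall>v. v ` fv \<theta> \<subseteq> J \<and> inj_on r (v ` fv \<theta>) \<longrightarrow>
      (sat M (\<lambda>n. c' (v n)) \<theta> \<longleftrightarrow> sat M (\<lambda>n. c (r (v n))) \<theta>))"
proof -
  have "\<exists>c'. inj_on c' (K \<union> X) \<and> range c' \<subseteq> univ M \<and> (\<forall>k\<in>K. c' k = c k) \<and>
    (\<forall>\<theta>\<in>F. \<forall>v. v ` fv \<theta> \<subseteq> K \<union> X \<and> inj_on r (v ` fv \<theta>) \<longrightarrow>
      (sat M (\<lambda>n. c' (v n)) \<theta> \<longleftrightarrow> sat M (\<lambda>n. c (r (v n))) \<theta>))" if "finite X" "X \<subseteq> J - K" for X
    using that
  proof (induction X rule: finite_induct)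
    case empty
    have "sat M (\<lambda>n. c (v n)) \<theta> \<longleftrightarrow> sat M (\<lambda>n. c (r (v n))) \<theta>" if "v ` fv \<theta> \<subseteq> K" for \<theta> v
      using that r(2) by (intro sat_cong) (auto simp: image_subset_iff)
    then show ?case using c by (intro exI[of _ c]) auto
  next
    case (insert j X)
    then obtain c' where c': "inj_on c' (K \<union> X)" "range c' \<subseteq> univ M" "\<And>k. k \<in> K \<Longrightarrow> c' k = c k"
      and sim: "\<And>\<theta> v. \<theta> \<in> F \<Longrightarrow> v ` fv \<theta> \<subseteq> K \<union> X \<Longrightarrow> inj_on r (v ` fv \<theta>) \<Longrightarrow>
        sat M (\<lambda>n. c' (v n)) \<theta> \<longleftrightarrow> sat M (\<lambda>n. c (r (v n))) \<theta>"
      using insert.IH[OF insert_subset[THEN iffD1, THEN conjunct2, OF insert.prems]] by metis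
    define i where "i = r j"
    have i: "i \<in> K" "r i = i" using r insert.prems by (auto simp: i_def)
    have j: "j \<notin> K \<union> X" using insert by auto
    have fin: "finite (K \<union> X)"
      using J K insert by (auto intro: finite_subset)
    have "infinite {d \<in> univ M. \<forall>\<theta>\<in>F. \<forall>v. v ` fv \<theta> \<subseteq> K \<union> X \<longrightarrow>
        (sat M (\<lambda>n. (c'(i := d)) (v n)) \<theta> \<longleftrightarrow> sat M (\<lambda>n. c' (v n)) \<theta>)}" (is "infinite ?D")
      using fin c' i F by (intro infinitely_many_similar) auto
    then have "\<not> ?D \<subseteq> c' ` (K \<union> X)"
      using fin by (meson finite_imageI finite_subset)
    then obtain d where "d \<in> ?D" "d \<notin> c' ` (K \<union> X)" by blast
    then have d: "d \<in> univ M" "d \<notin> c' ` (K \<union> X)"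
      and dsim: "\<And>\<theta> v. \<theta> \<in> F \<Longrightarrow> v ` fv \<theta> \<subseteq> K \<union> X \<Longrightarrow>
        sat M (\<lambda>n. (c'(i := d)) (v n)) \<theta> \<longleftrightarrow> sat M (\<lambda>n. c' (v n)) \<theta>"
      by blast+
    have "sat M (\<lambda>n. (c'(j := d)) (v n)) \<theta> \<longleftrightarrow> sat M (\<lambda>n. c (r (v n))) \<theta>"
      if \<theta>: "\<theta> \<in> F" and v: "v ` fv \<theta> \<subseteq> K \<union> insert j X" and inj: "inj_on r (v ` fv \<theta>)" for \<theta> v
    proof (cases "j \<in> v ` fv \<theta>")
      case False
      then have "sat M (\<lambda>n. (c'(j := d)) (v n)) \<theta> \<longleftrightarrow> sat M (\<lambda>n. c' (v n)) \<theta>"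
        by (intro sat_cong) auto
      also have "\<dots> \<longleftrightarrow> sat M (\<lambda>n. c (r (v n))) \<theta>"
        using False v inj by (intro sim \<theta>) auto
      finally show ?thesis .
    next
      case True
      \<comment> \<open>A tuple that contains \<open>j\<close> does not contain its original
        \<open>i\<close>, as \<open>r\<close> is injective on it. So giving \<open>j\<close> the
        value \<open>d\<close> has the same effect as moving \<open>j\<close> to \<open>i\<close>
        and changing the value at \<open>i\<close> to \<open>d\<close>.\<close>
      define v' where "v' = (\<lambda>n. if v n = j then i else v n)"
      have rv': "r (v' n) = r (v n)" for n
        using i by (auto simp: v'_def i_def)
      have ne: "v n \<noteq> i" if "n \<in> fv \<theta>" "v n \<noteq> j" for n
      proof
        assume "v n = i"
        then have "r (v n) = r j" using i by (simp add: i_def)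
        then show False using inj_onD[OF inj, of "v n" j] that True by auto
      qed
      have v'K: "v' ` fv \<theta> \<subseteq> K \<union> X"
        using v i by (auto simp: v'_def)
      have inj': "inj_on r (v' ` fv \<theta>)"
      proof (rule inj_onI)
        fix x y assume "x \<in> v' ` fv \<theta>" "y \<in> v' ` fv \<theta>" "r x = r y"
        then obtain p q where pq: "p \<in> fv \<theta>" "q \<in> fv \<theta>" "x = v' p" "y = v' q" by blast
        then have "r (v p) = r (v q)" using \<open>r x = r y\<close> rv' by simp
        then have "v p = v q" using inj pq by (auto dest: inj_onD)
        then show "x = y" using pq by (simp add: v'_def)
      qed
      have "sat M (\<lambda>n. (c'(j := d)) (v n)) \<theta> \<longleftrightarrow> sat M (\<lambda>n. (c'(i := d)) (v' n)) \<theta>"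
        using ne by (intro sat_cong) (auto simp: v'_def)
      also have "\<dots> \<longleftrightarrow> sat M (\<lambda>n. c' (v' n)) \<theta>"
        by (rule dsim[OF \<theta> v'K])
      also have "\<dots> \<longleftrightarrow> sat M (\<lambda>n. c (r (v' n))) \<theta>"
        by (rule sim[OF \<theta> v'K inj'])
      also have "\<dots> \<longleftrightarrow> sat M (\<lambda>n. c (r (v n))) \<theta>"
        by (intro sat_cong) (simp add: rv')
      finally show ?thesis .
    qed
    moreover have "inj_on (c'(j := d)) (K \<union> insert j X)"
      using c'(1) d j by (auto simp: inj_on_def)
    moreover have "range (c'(j := d)) \<subseteq> univ M"
      using c'(2) d by auto
    moreover have "\<forall>k\<in>K. (c'(j := d)) k = c k"
      using c'(3) j by auto
    ultimately show ?case by blast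
  qed
  from this[of "J - K"] show ?thesis
    using J K by (simp add: Un_absorb1)
qed

text \<open>With no formulas to preserve, any retraction of \<open>J\<close> to \<open>K\<close> can
  be used in \<open>duplicate\<close>.\<close>

lemma extend_injection:
  assumes "finite J" "K \<subseteq> J" "K \<noteq> {}" "inj_on c K" "range c \<subseteq> univ M"
  shows "\<exists>c'. inj_on c' J \<and> range c' \<subseteq> univ M \<and> (\<forall>k\<in>K. c' k = c k)"
proof -
  obtain k where "k \<in> K" using assms by blast
  then show ?thesis
    using duplicate[of J K "\<lambda>j. if j \<in> K then j else k" c "{}"] assms by auto
qed

end

section \<open>Approximations\<close>

lemma countable_exhaustion:
  assumes "countable A"
  obtains B :: "nat \<Rightarrow> 'a set" where "\<And>n. finite (B n)" "mono B" "(\<Union>n. B n) = A"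
proof (cases "A = {}")
  case True
  then show ?thesis by (intro that[of "\<lambda>_. {}"]) (auto simp: mono_def)
next
  case False
  show ?thesis
  proof (rule that[of "\<lambda>n. from_nat_into A ` {..n}"])
    have "(\<Union>n. from_nat_into A ` {..n}) = range (from_nat_into A)" by auto
    then show "(\<Union>n. from_nat_into A ` {..n}) = A"
      using range_from_nat_into[OF False assms] by simp
  qed (auto simp: mono_def)
qed

section \<open>Truncation of points and finite levels\<close>

definition trunc :: "nat \<Rightarrow> cantor \<Rightarrow> cantor" where
  "trunc l \<eta> = (\<lambda>j. j < l \<and> \<eta> j)"

definition tr :: "nat \<Rightarrow> cantor \<times> nat \<Rightarrow> cantor \<times> nat" where
  "tr l z = (trunc l (fst z), snd z)"

text \<open>\<open>2^l\<close> points in each of the first \<open>n\<close> columns, the nodes of \<open>2^l\<close> being represented by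
  their extensions by zeros.  So \<open>level l n \<subseteq> level (l + 1) n\<close>, and of the two successors of a node
  one is the node itself.\<close>

definition level :: "nat \<Rightarrow> nat \<Rightarrow> (cantor \<times> nat) set" where
  "level l n = {z. tr l z = z \<and> snd z < n}"

lemma snd_tr [simp]: "snd (tr l z) = snd z"
  by (simp add: tr_def)

lemma tr_tr: "tr l (tr m z) = tr (min l m) z"
  by (auto simp: tr_def trunc_def fun_eq_iff)

lemma tr_eq_iff: "tr l z = tr l w \<longleftrightarrow> (\<forall>j<l. fst z j = fst w j) \<and> snd z = snd w"
  by (auto simp: tr_def trunc_def fun_eq_iff)

lemma tr_in_level: "tr l z \<in> level l n \<longleftrightarrow> snd z < n"
  by (simp add: level_def tr_tr)

lemma tr_level: "z \<in> level l n \<Longrightarrow> tr l z = z"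
  by (simp add: level_def)

lemma level_mono: "l \<le> l' \<Longrightarrow> n \<le> n' \<Longrightarrow> level l n \<subseteq> level l' n'"
  unfolding level_def by (auto simp: tr_def trunc_def fun_eq_iff) (metis order_less_le_trans)

lemma finite_level: "finite (level l n)"
proof -
  have "level l n \<subseteq> (\<lambda>X. (\<lambda>j. j \<in> X)) ` Pow {..<l} \<times> {..<n}"
  proof
    fix z assume z: "z \<in> level l n"
    then have "fst z = (\<lambda>j. j < l \<and> fst z j)"
      by (simp add: level_def tr_def trunc_def prod_eq_iff)
    then have "fst z = (\<lambda>X. (\<lambda>j. j \<in> X)) {j. j < l \<and> fst z j}" by simp
    then have "fst z \<in> (\<lambda>X. (\<lambda>j. j \<in> X)) ` Pow {..<l}" by (rule image_eqI) auto
    then show "z \<in> (\<lambda>X. (\<lambda>j. j \<in> X)) ` Pow {..<l} \<times> {..<n}"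
      using z by (auto simp: level_def mem_Times_iff)
  qed
  then show ?thesis by (rule finite_subset) auto
qed

lemma zero_in_level: "(\<lambda>_. False, i) \<in> level l n \<longleftrightarrow> i < n"
  by (simp add: level_def tr_def trunc_def)

lemma tr_eq_mono: "l \<le> m \<Longrightarrow> tr m z = tr m w \<Longrightarrow> tr l z = tr l w"
  by (auto simp: tr_eq_iff)

lemma eventually_inj_on_tr:
  assumes "finite A"
  shows "\<forall>\<^sub>F l in sequentially. inj_on (tr l) A"
proof -
  have "\<forall>\<^sub>F l in sequentially. tr l z = tr l w \<longrightarrow> z = w" for z w
  proof (cases "z = w")
    case False
    then obtain m where m: "tr m z \<noteq> tr m w"
      unfolding tr_eq_iff by (auto simp: prod_eq_iff fun_eq_iff)
    then show ?thesis
      unfolding eventually_sequentially by (metis tr_eq_mono)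
  qed simp
  then have "\<forall>\<^sub>F l in sequentially. \<forall>z\<in>A. \<forall>w\<in>A. tr l z = tr l w \<longrightarrow> z = w"
    using assms by (intro eventually_ball_finite ballI) auto
  then show ?thesis by (simp add: inj_on_def)
qed

text \<open>What the construction hands over to the limit. In \<open>coherent\<close>, the entries
  must lie over distinct nodes of length \<open>l\<close>: nothing is promised about two copies of
  the same node. In \<open>witness\<close>, only the column of the witness may be new; the point has
  length \<open>l\<close> and is therefore its own truncation. In \<open>omit\<close>, the falsified
  formula belongs to \<open>F (Suc l)\<close>, so \<open>coherent\<close> keeps it false at later
  levels while the entries lie over distinct nodes.\<close>

locale approximation =
  fixes L :: "('f, 'r) language" and M :: "('f, 'r, 'a) fo_struct"
    and c :: "cantor \<times> nat \<Rightarrow> 'a" and n :: "nat \<Rightarrow> nat" and F :: "nat \<Rightarrow> ('f, 'r) fm set"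
    and \<Delta> :: "(nat \<times> ('f, 'r) fm set) set"
  assumes struct: "is_struct L M"
    and strict_mono_n: "strict_mono n"
    and mono_F: "mono F"
    and F_exhaust: "(\<Union>l. F l) = {\<theta>. wf_fm L \<theta>}"
    and c_range: "range c \<subseteq> univ M"
    and c_inj: "inj_on c (level l (n l))"
    and coherent: "\<theta> \<in> F (Suc l) \<Longrightarrow> v ` fv \<theta> \<subseteq> level (Suc l) (n (Suc l)) \<Longrightarrow>
      inj_on (tr l) (v ` fv \<theta>) \<Longrightarrow> sat M (\<lambda>j. c (v j)) \<theta> \<longleftrightarrow> sat M (\<lambda>j. c (tr l (v j))) \<theta>"
    and witness: "Exi x \<theta> \<in> F (Suc l) \<Longrightarrow> v ` (fv \<theta> - {x}) \<subseteq> level l (n l) \<Longrightarrow>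
      sat M (\<lambda>j. c (v j)) (Exi x \<theta>) \<Longrightarrow> \<exists>q\<in>level l (n (Suc l)). sat M (\<lambda>j. c ((v(x := q)) j)) \<theta>"
    and omit: "(k, p) \<in> \<Delta> \<Longrightarrow> \<exists>l0. \<forall>l\<ge>l0. \<forall>v. v ` {..<k} \<subseteq> level l (n l) \<longrightarrow>
      (\<exists>\<phi>\<in>p \<inter> F (Suc l). \<not> sat M (\<lambda>j. c (v j)) \<phi>)"

section \<open>Construction of an approximation in stages\<close>

context trivial_dcl_struct
begin

text \<open>An element of \<open>W\<close> that is not yet a value is put at the zero node of a
  fresh column, and the rest of the column is filled injectively. A column is added even for empty
  \<open>W\<close>, so the number of columns strictly grows and every column eventually
  appears.\<close>

lemma add_witnesses:
  assumes n: "0 < n" and c: "inj_on c (level l n)" "range c \<subseteq> univ M"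
    and W: "finite W" "W \<subseteq> univ M"
  shows "\<exists>n'>n. \<exists>c'. inj_on c' (level l n') \<and> range c' \<subseteq> univ M \<and>
    (\<forall>q\<in>level l n. c' q = c q) \<and> W \<subseteq> c' ` level l n'"
  using W
proof (induction W rule: finite_induct)
  case empty
  have "level l n \<noteq> {}" using n zero_in_level by blast
  then show ?case
    using extend_injection[OF finite_level[of l "Suc n"] level_mono[of l l n "Suc n"] _ c]
    by auto
next
  case (insert w W)
  then obtain n1 c1 where n1: "n1 > n" and c1: "inj_on c1 (level l n1)" "range c1 \<subseteq> univ M"
    "\<forall>q\<in>level l n. c1 q = c q" "W \<subseteq> c1 ` level l n1"
    by auto
  show ?case
  proof (cases "w \<in> c1 ` level l n1")
    case True
    then show ?thesis using n1 c1 by blast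
  next
    case False
    define z :: "cantor \<times> nat" where "z = (\<lambda>_. False, n1)"
    have z: "z \<notin> level l n1" "z \<in> level l (Suc n1)" by (simp_all add: z_def zero_in_level)
    define K where "K = insert z (level l n1)"
    have "inj_on (c1(z := w)) K"
      using c1(1) False z(1) by (auto simp: K_def inj_on_def)
    moreover have "range (c1(z := w)) \<subseteq> univ M"
      using c1(2) insert.prems by auto
    moreover have "K \<subseteq> level l (Suc n1)"
      using z(2) level_mono[of l l n1 "Suc n1"] by (auto simp: K_def)
    ultimately obtain c2 where c2: "inj_on c2 (level l (Suc n1))" "range c2 \<subseteq> univ M"
      "\<forall>k\<in>K. c2 k = (c1(z := w)) k"
      using extend_injection[OF finite_level, of K l "Suc n1" "c1(z := w)"] by (auto simp: K_def)
    have eq: "c2 q = c1 q" if "q \<in> level l n1" for q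
      using c2(3) that z(1) by (auto simp: K_def)
    have sub: "level l n \<subseteq> level l n1" "level l n1 \<subseteq> level l (Suc n1)"
      using n1 by (simp_all add: level_mono)
    have "w = c2 z" using c2(3) by (simp add: K_def)
    then have "w \<in> c2 ` level l (Suc n1)" using z(2) by simp
    moreover have im: "c1 ` level l n1 = c2 ` level l n1"
      using eq by (intro image_cong) auto
    have "W \<subseteq> c2 ` level l (Suc n1)"
      using c1(4)[unfolded im] image_mono[OF sub(2), of c2] by (rule order_trans)
    ultimately have "insert w W \<subseteq> c2 ` level l (Suc n1)" by simp
    moreover have "\<forall>q\<in>level l n. c2 q = c q"
    proof
      fix q assume q: "q \<in> level l n"
      then have "c2 q = c1 q" using sub(1) by (intro eq) blast
      then show "c2 q = c q" using c1(3) q by simp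
    qed
    moreover have "n < Suc n1" using n1 by simp
    ultimately show ?thesis using c2(1,2) by blast
  qed
qed

text \<open>As \<open>M\<close> omits \<open>p\<close>, every tuple falsifies some member of
  \<open>p\<close>. One such formula is chosen for each type and each placing of its variables on
  \<open>I\<close>, repetitions included; restricting placings to \<open>{..<k}\<close> leaves
  finitely many choices.\<close>

lemma falsified_formulas:
  assumes c: "range c \<subseteq> univ M" and I: "finite I"
    and D: "finite D" "\<And>k p \<phi>. (k, p) \<in> D \<Longrightarrow> \<phi> \<in> p \<Longrightarrow> formula L k \<phi>"
      "\<And>k p. (k, p) \<in> D \<Longrightarrow> omits M k p"
  shows "\<exists>G. finite G \<and> (\<forall>\<theta>\<in>G. wf_fm L \<theta>) \<and>
    (\<forall>(k, p)\<in>D. \<forall>v. v ` {..<k} \<subseteq> I \<longrightarrow> (\<exists>\<phi>\<in>p \<inter> G. \<not> sat M (\<lambda>j. c (v j)) \<phi>))"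
proof -
  have ex: "\<exists>\<phi>\<in>p. \<not> sat M (\<lambda>j. c (v j)) \<phi>" if kp: "(k, p) \<in> D" for k p v
  proof (rule ccontr)
    assume *: "\<not> ?thesis"
    have "(\<lambda>j\<in>{..<k}. c (v j)) \<in> {..<k} \<rightarrow>\<^sub>E univ M" using c by auto
    moreover have "sat M (\<lambda>j\<in>{..<k}. c (v j)) \<phi>" if "\<phi> \<in> p" for \<phi>
    proof -
      have "fv \<phi> \<subseteq> {..<k}" using D(2)[OF kp that] by (simp add: formula_def)
      then have "sat M (\<lambda>j\<in>{..<k}. c (v j)) \<phi> \<longleftrightarrow> sat M (\<lambda>j. c (v j)) \<phi>"
        by (intro sat_cong) auto
      then show ?thesis using * that by blast
    qed
    ultimately show False using D(3)[OF kp] unfolding omits_def by blast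
  qed
  define f where "f k p v = (SOME \<phi>. \<phi> \<in> p \<and> \<not> sat M (\<lambda>j. c (v j)) \<phi>)" for k :: nat and p v
  have f: "f k p v \<in> p" "\<not> sat M (\<lambda>j. c (v j)) (f k p v)" if "(k, p) \<in> D" for k p v
    using someI_ex[OF ex[OF that, unfolded Bex_def], of v] by (auto simp: f_def)
  define G where "G = (\<Union>(k, p)\<in>D. f k p ` ({..<k} \<rightarrow>\<^sub>E I))"
  have "finite G"
    using D(1) I by (auto simp: G_def intro!: finite_PiE)
  moreover have "wf_fm L \<theta>" if "\<theta> \<in> G" for \<theta>
  proof -
    from that obtain k p v where "(k, p) \<in> D" "\<theta> = f k p v" unfolding G_def by blast
    then have "formula L k \<theta>" using D(2)[of k p \<theta>] f(1)[of k p v] by blast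
    then show ?thesis by (simp add: formula_def)
  qed
  moreover have "\<exists>\<phi>\<in>p \<inter> G. \<not> sat M (\<lambda>j. c (v j)) \<phi>"
    if kp: "(k, p) \<in> D" and v: "v ` {..<k} \<subseteq> I" for k p v
  proof -
    define v' where "v' = restrict v {..<k}"
    have v': "v' \<in> {..<k} \<rightarrow>\<^sub>E I" using v by (auto simp: v'_def)
    define \<phi> where "\<phi> = f k p v'"
    have "formula L k \<phi>" using D(2)[OF kp f(1)[OF kp]] by (simp add: \<phi>_def)
    then have "sat M (\<lambda>j. c (v' j)) \<phi> \<longleftrightarrow> sat M (\<lambda>j. c (v j)) \<phi>"
      by (intro sat_cong) (auto simp: formula_def v'_def)
    moreover have "\<phi> \<in> G" unfolding G_def \<phi>_def using kp v' by blast
    ultimately show ?thesis using f[OF kp, of v'] unfolding \<phi>_def[symmetric] by blast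
  qed
  ultimately show ?thesis by (intro exI[of _ G]) auto
qed

lemma finite_witness_set:
  assumes F: "finite F" and I: "finite I"
  shows "\<exists>W. finite W \<and> W \<subseteq> univ M \<and> (\<forall>x \<theta> v. Exi x \<theta> \<in> F \<longrightarrow> v ` (fv \<theta> - {x}) \<subseteq> I \<longrightarrow>
    sat M (\<lambda>j. c (v j)) (Exi x \<theta>) \<longrightarrow> (\<exists>w\<in>W. sat M ((\<lambda>j. c (v j))(x := w)) \<theta>))"
proof -
  define w where "w x \<theta> v = (SOME a. a \<in> univ M \<and> sat M ((\<lambda>j. c (v j))(x := a)) \<theta>)" for x \<theta> v
  define E where "E = (\<lambda>(x, \<theta>). Exi x \<theta>) -` F"
  have "finite E" unfolding E_def using F by (intro finite_vimageI) (auto simp: inj_def)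
  \<comment> \<open>The choice \<open>w\<close> is arbitrary where the existential formula fails;
    the intersection discards such values outside the universe.\<close>
  define W where "W = (\<Union>(x, \<theta>)\<in>E. w x \<theta> ` ((fv \<theta> - {x}) \<rightarrow>\<^sub>E I)) \<inter> univ M"
  have "finite W" unfolding W_def
    using \<open>finite E\<close> I by (intro finite_Int disjI1 finite_UN_I) (auto intro!: finite_PiE finite_fv)
  moreover have "\<exists>w\<in>W. sat M ((\<lambda>j. c (v j))(x := w)) \<theta>"
    if ex: "Exi x \<theta> \<in> F" and v: "v ` (fv \<theta> - {x}) \<subseteq> I" and sat: "sat M (\<lambda>j. c (v j)) (Exi x \<theta>)" for x \<theta> v
  proof -
    define v' where "v' = restrict v (fv \<theta> - {x})"
    have v': "v' \<in> (fv \<theta> - {x}) \<rightarrow>\<^sub>E I" using v by (auto simp: v'_def)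
    have cong: "sat M ((\<lambda>j. c (v' j))(x := a)) \<theta> \<longleftrightarrow> sat M ((\<lambda>j. c (v j))(x := a)) \<theta>" for a
      by (intro sat_cong) (auto simp: v'_def)
    have "\<exists>a. a \<in> univ M \<and> sat M ((\<lambda>j. c (v' j))(x := a)) \<theta>"
      using sat unfolding cong by auto
    from someI_ex[OF this]
    have "w x \<theta> v' \<in> univ M \<and> sat M ((\<lambda>j. c (v' j))(x := w x \<theta> v')) \<theta>"
      unfolding w_def[symmetric] .
    then have "w x \<theta> v' \<in> univ M" "sat M ((\<lambda>j. c (v j))(x := w x \<theta> v')) \<theta>"
      unfolding cong by blast+
    moreover have "(x, \<theta>) \<in> E" using ex by (simp add: E_def)
    ultimately show ?thesis unfolding W_def using v' by blast
  qed
  ultimately show ?thesis by (intro exI[of _ W]) (auto simp: W_def)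
qed

definition stage where
  "stage l s = (case s of (n, F, c) \<Rightarrow> 0 < n \<and> finite F \<and> (\<forall>\<theta>\<in>F. wf_fm L \<theta>) \<and>
     inj_on c (level l n) \<and> range c \<subseteq> univ M)"

definition next_stage where
  "next_stage D l s s' = (case s of (n, F, c) \<Rightarrow> case s' of (n', F', c') \<Rightarrow>
     n < n' \<and> F \<subseteq> F' \<and> (\<forall>q\<in>level l n. c' q = c q) \<and>
     (\<forall>\<theta>\<in>F'. \<forall>v. v ` fv \<theta> \<subseteq> level (Suc l) n' \<longrightarrow> inj_on (tr l) (v ` fv \<theta>) \<longrightarrow>
        (sat M (\<lambda>j. c' (v j)) \<theta> \<longleftrightarrow> sat M (\<lambda>j. c' (tr l (v j))) \<theta>)) \<and>
     (\<forall>x \<theta> v. Exi x \<theta> \<in> F' \<longrightarrow> v ` (fv \<theta> - {x}) \<subseteq> level l n \<longrightarrow>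
        sat M (\<lambda>j. c' (v j)) (Exi x \<theta>) \<longrightarrow> (\<exists>q\<in>level l n'. sat M (\<lambda>j. c' ((v(x := q)) j)) \<theta>)) \<and>
     (\<forall>(k, p)\<in>D. \<forall>v. v ` {..<k} \<subseteq> level l n \<longrightarrow> (\<exists>\<phi>\<in>p \<inter> F'. \<not> sat M (\<lambda>j. c' (v j)) \<phi>)))"

text \<open>The formulas \<open>F'\<close> are fixed first, including those that falsify the types
  in \<open>D\<close>, so that the doubling preserves their truth values. Then columns with
  witnesses for \<open>F'\<close> are added at length \<open>l\<close>, and finally all nodes are
  doubled by \<open>duplicate\<close> with \<open>tr l\<close> as retraction.\<close>

lemma ex_next_stage:
  assumes s: "stage l (n, F, c)"
    and D: "finite D" "\<And>k p \<phi>. (k, p) \<in> D \<Longrightarrow> \<phi> \<in> p \<Longrightarrow> formula L k \<phi>"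
      "\<And>k p. (k, p) \<in> D \<Longrightarrow> omits M k p"
    and H: "finite H" "\<forall>\<theta>\<in>H. wf_fm L \<theta>"
  shows "\<exists>n' F' c'. stage (Suc l) (n', F', c') \<and> H \<subseteq> F' \<and> next_stage D l (n, F, c) (n', F', c')"
proof -
  have n: "0 < n" and F: "finite F" "\<forall>\<theta>\<in>F. wf_fm L \<theta>"
    and c: "inj_on c (level l n)" "range c \<subseteq> univ M"
    using s by (auto simp: stage_def)
  obtain G where G: "finite G" "\<forall>\<theta>\<in>G. wf_fm L \<theta>"
    and Gomit: "\<forall>(k, p)\<in>D. \<forall>v. v ` {..<k} \<subseteq> level l n \<longrightarrow> (\<exists>\<phi>\<in>p \<inter> G. \<not> sat M (\<lambda>j. c (v j)) \<phi>)"
  proof -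
    have "\<exists>G. finite G \<and> (\<forall>\<theta>\<in>G. wf_fm L \<theta>) \<and>
      (\<forall>(k, p)\<in>D. \<forall>v. v ` {..<k} \<subseteq> level l n \<longrightarrow> (\<exists>\<phi>\<in>p \<inter> G. \<not> sat M (\<lambda>j. c (v j)) \<phi>))"
      by (rule falsified_formulas[OF c(2) finite_level D(1)]) (use D in blast)+
    then show ?thesis using that by blast
  qed
  define F' where "F' = F \<union> G \<union> H"
  have F': "finite F'" "\<And>\<theta>. \<theta> \<in> F' \<Longrightarrow> wf_fm L \<theta>" using F G H by (auto simp: F'_def)
  obtain W where W: "finite W" "W \<subseteq> univ M" "\<And>x \<theta> v. Exi x \<theta> \<in> F' \<Longrightarrow>
      v ` (fv \<theta> - {x}) \<subseteq> level l n \<Longrightarrow> sat M (\<lambda>j. c (v j)) (Exi x \<theta>) \<Longrightarrow>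
      \<exists>w\<in>W. sat M ((\<lambda>j. c (v j))(x := w)) \<theta>"
    using finite_witness_set[OF F'(1) finite_level[of l n]] by metis
  obtain n' c1 where n': "n' > n" and c1: "inj_on c1 (level l n')" "range c1 \<subseteq> univ M"
    "\<forall>q\<in>level l n. c1 q = c q" "W \<subseteq> c1 ` level l n'"
    using add_witnesses[OF n c W(1,2)] by auto
  have sub: "level l n \<subseteq> level l n'" "level l n' \<subseteq> level (Suc l) n'"
    using n' by (simp_all add: level_mono)
  have "tr l ` level (Suc l) n' \<subseteq> level l n'"
    by (auto simp: tr_in_level) (simp add: level_def)
  then have "\<exists>c'. inj_on c' (level (Suc l) n') \<and> range c' \<subseteq> univ M \<and>
      (\<forall>k\<in>level l n'. c' k = c1 k) \<and>
      (\<forall>\<theta>\<in>F'. \<forall>v. v ` fv \<theta> \<subseteq> level (Suc l) n' \<and> inj_on (tr l) (v ` fv \<theta>) \<longrightarrow>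
        (sat M (\<lambda>j. c' (v j)) \<theta> \<longleftrightarrow> sat M (\<lambda>j. c1 (tr l (v j))) \<theta>))"
    by (rule duplicate[OF finite_level sub(2) _ _ c1(1,2) F']) (simp_all add: tr_level)
  then obtain c' where c': "inj_on c' (level (Suc l) n')" "range c' \<subseteq> univ M"
      "\<forall>k\<in>level l n'. c' k = c1 k"
    and sim: "\<And>\<theta> v. \<theta> \<in> F' \<Longrightarrow> v ` fv \<theta> \<subseteq> level (Suc l) n' \<Longrightarrow> inj_on (tr l) (v ` fv \<theta>) \<Longrightarrow>
      sat M (\<lambda>j. c' (v j)) \<theta> \<longleftrightarrow> sat M (\<lambda>j. c1 (tr l (v j))) \<theta>"
    by blast
  have c'c: "c' q = c q" if "q \<in> level l n" for q
    using that sub(1) c'(3) c1(3) by auto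
  have coh: "sat M (\<lambda>j. c' (v j)) \<theta> \<longleftrightarrow> sat M (\<lambda>j. c' (tr l (v j))) \<theta>"
    if "\<theta> \<in> F'" and v: "v ` fv \<theta> \<subseteq> level (Suc l) n'" and "inj_on (tr l) (v ` fv \<theta>)" for \<theta> v
  proof -
    have "sat M (\<lambda>j. c1 (tr l (v j))) \<theta> \<longleftrightarrow> sat M (\<lambda>j. c' (tr l (v j))) \<theta>"
    proof (rule sat_cong)
      fix j assume "j \<in> fv \<theta>"
      then have "v j \<in> level (Suc l) n'" using v by blast
      then have "tr l (v j) \<in> level l n'" unfolding tr_in_level by (simp add: level_def)
      then show "c1 (tr l (v j)) = c' (tr l (v j))" using c'(3) by simp
    qed
    then show ?thesis using sim[OF that] by blast
  qed
  have wit: "\<exists>q\<in>level l n'. sat M (\<lambda>j. c' ((v(x := q)) j)) \<theta>"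
    if ex: "Exi x \<theta> \<in> F'" and v: "v ` (fv \<theta> - {x}) \<subseteq> level l n"
      and sat: "sat M (\<lambda>j. c' (v j)) (Exi x \<theta>)" for x \<theta> v
  proof -
    have cv: "c' (v j) = c (v j)" if "j \<in> fv \<theta> - {x}" for j
      using v that by (auto intro!: c'c)
    have "sat M (\<lambda>j. c' (v j)) (Exi x \<theta>) \<longleftrightarrow> sat M (\<lambda>j. c (v j)) (Exi x \<theta>)"
      by (rule sat_cong) (simp add: cv)
    then obtain w where "w \<in> W" and w: "sat M ((\<lambda>j. c (v j))(x := w)) \<theta>"
      using W(3)[OF ex v] sat by blast
    then obtain q where q: "q \<in> level l n'" "w = c' q"
      using c1(4) c'(3) by auto
    have "sat M (\<lambda>j. c' ((v(x := q)) j)) \<theta> \<longleftrightarrow> sat M ((\<lambda>j. c (v j))(x := w)) \<theta>"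
      by (rule sat_cong) (auto simp: cv q)
    then show ?thesis using w q by blast
  qed
  have om: "\<exists>\<phi>\<in>p \<inter> F'. \<not> sat M (\<lambda>j. c' (v j)) \<phi>"
    if kp: "(k, p) \<in> D" and v: "v ` {..<k} \<subseteq> level l n" for k p v
  proof -
    obtain \<phi> where \<phi>: "\<phi> \<in> p" "\<phi> \<in> G" "\<not> sat M (\<lambda>j. c (v j)) \<phi>"
      using Gomit kp v by blast
    have "fv \<phi> \<subseteq> {..<k}" using D(2)[OF kp \<phi>(1)] by (simp add: formula_def)
    then have "sat M (\<lambda>j. c' (v j)) \<phi> \<longleftrightarrow> sat M (\<lambda>j. c (v j)) \<phi>"
      using v by (intro sat_cong c'c) auto
    then show ?thesis using \<phi> by (auto simp: F'_def)
  qed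
  have "stage (Suc l) (n', F', c')"
    unfolding stage_def prod.case using n n' F' c'(1,2) by simp
  moreover have "next_stage D l (n, F, c) (n', F', c')"
    unfolding next_stage_def prod.case using n' c'c coh wit om
    by (intro conjI allI ballI impI) (auto simp: F'_def)
  ultimately show ?thesis by (intro exI[of _ n'] exI[of _ F'] exI[of _ c']) (auto simp: F'_def)
qed

text \<open>Dependent choice over the stages, fed with growing finite parts \<open>H l\<close> of
  the set of formulas and \<open>D l\<close> of \<open>\<Delta>\<close>. Every stage keeps the
  earlier values, so the maps have a common extension \<open>c\<close>.\<close>

lemma ex_approximation:
  assumes lang: "countable_language L"
    and \<Delta>: "countable \<Delta>" "\<And>k p \<phi>. (k, p) \<in> \<Delta> \<Longrightarrow> \<phi> \<in> p \<Longrightarrow> formula L k \<phi>"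
      "\<And>k p. (k, p) \<in> \<Delta> \<Longrightarrow> omits M k p"
  shows "\<exists>c n F. approximation L M c n F \<Delta>"
proof -
  obtain H :: "nat \<Rightarrow> ('f, 'r) fm set" where H: "\<And>l. finite (H l)" "mono H" "(\<Union>l. H l) = {\<theta>. wf_fm L \<theta>}"
    using countable_exhaustion[OF countable_wf_fm[OF lang]] by metis
  obtain D :: "nat \<Rightarrow> (nat \<times> ('f, 'r) fm set) set" where D: "\<And>l. finite (D l)" "mono D" "(\<Union>l. D l) = \<Delta>"
    using countable_exhaustion[OF \<Delta>(1)] by metis
  obtain u where u: "u \<in> univ M" using univ_nonempty by blast
  have "\<exists>f. \<forall>l. stage l (f l) \<and> H l \<subseteq> fst (snd (f (Suc l))) \<and> next_stage (D l) l (f l) (f (Suc l))"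
  proof -
    have "\<exists>f. \<forall>l. stage l (f l) \<and> (H l \<subseteq> fst (snd (f (Suc l))) \<and> next_stage (D l) l (f l) (f (Suc l)))"
    proof (rule dependent_nat_choice)
      \<comment> \<open>The construction starts with one column and the empty word, a single point;
        hence a constant map is injective there.\<close>
      have "z = w" if "z \<in> level 0 1" "w \<in> level 0 1" for z w
        using that by (auto simp: level_def tr_def trunc_def prod_eq_iff)
      then have "inj_on (\<lambda>_. u) (level 0 1)" by (auto simp: inj_on_def)
      then show "\<exists>s. stage 0 s"
        using u by (intro exI[of _ "(1, {}, \<lambda>_. u)"]) (auto simp: stage_def)
    next
      fix s l assume s: "stage l s"
      obtain n F c where s_eq: "s = (n, F, c)" by (cases s)
      have "D l \<subseteq> \<Delta>" using D(3) by blast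
      moreover have "\<forall>\<theta>\<in>H l. wf_fm L \<theta>" using H(3) by blast
      ultimately obtain n' F' c' where
        "stage (Suc l) (n', F', c')" "H l \<subseteq> F'" "next_stage (D l) l (n, F, c) (n', F', c')"
        using ex_next_stage[OF s[unfolded s_eq] D(1) _ _ H(1), of l l] \<Delta>(2,3)
        by (metis (no_types, lifting) subsetD)
      then show "\<exists>s'. stage (Suc l) s' \<and> (H l \<subseteq> fst (snd s') \<and> next_stage (D l) l s s')"
        unfolding s_eq by (intro exI[of _ "(n', F', c')"]) simp
    qed
    then show ?thesis by simp
  qed
  then obtain f where f: "\<And>l. stage l (f l)" "\<And>l. H l \<subseteq> fst (snd (f (Suc l)))"
    "\<And>l. next_stage (D l) l (f l) (f (Suc l))" by blast
  define n where "n l = fst (f l)" for l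
  define F where "F l = fst (snd (f l))" for l
  define C where "C l = snd (snd (f l))" for l
  have f_eq: "f l = (n l, F l, C l)" for l by (simp add: n_def F_def C_def)
  note st = f(1)[unfolded f_eq stage_def prod.case]
  note nx = f(3)[unfolded f_eq next_stage_def prod.case]
  have n: "strict_mono n" using nx by (intro strict_monoI_Suc) blast
  have F: "mono F" using nx by (intro mono_iff_le_Suc[THEN iffD2]) blast
  have n_le: "n l \<le> n m" if "l \<le> m" for l m
    using n that by (simp add: strict_mono_less_eq)
  have lev: "level l (n l) \<subseteq> level m (n m)" if "l \<le> m" for l m
    using that n_le by (intro level_mono) auto
  have C_le: "C m q = C l q" if "l \<le> m" "q \<in> level l (n l)" for l m q
    using that(1)
  proof (induction m rule: dec_induct)
    case (step m)
    then have "q \<in> level m (n m)" using lev that(2) by blast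
    then have "C (Suc m) q = C m q" using nx by blast
    then show ?case using step by simp
  qed simp
  \<comment> \<open>The first stage that contains \<open>q\<close> gives the value. If no stage
    does, the stage is unspecified, but its map still takes values in \<open>univ M\<close>.\<close>
  define c where "c q = C (LEAST l. q \<in> level l (n l)) q" for q
  have cC: "c q = C l q" if "q \<in> level l (n l)" for q l
    using C_le[OF Least_le[where P = "\<lambda>l. q \<in> level l (n l)", OF that]
        LeastI[where P = "\<lambda>l. q \<in> level l (n l)", OF that]]
    by (simp add: c_def)
  have "approximation L M c n F \<Delta>"
  proof
    show "is_struct L M" by (rule struct)
    show "strict_mono n" by fact
    show "mono F" by fact
    have "H l \<subseteq> F (Suc l)" for l using f(2)[of l] by (simp add: F_def)
    moreover have "F l \<subseteq> {\<theta>. wf_fm L \<theta>}" for l using st[of l] by blast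
    ultimately show "(\<Union>l. F l) = {\<theta>. wf_fm L \<theta>}" unfolding H(3)[symmetric] by blast
    show "range c \<subseteq> univ M" using st by (auto simp: c_def)
    show "inj_on c (level l (n l))" for l
      using st[of l] cC by (auto simp: inj_on_def)
    show "sat M (\<lambda>j. c (v j)) \<theta> \<longleftrightarrow> sat M (\<lambda>j. c (tr l (v j))) \<theta>"
      if \<theta>: "\<theta> \<in> F (Suc l)" and v: "v ` fv \<theta> \<subseteq> level (Suc l) (n (Suc l))"
        and inj: "inj_on (tr l) (v ` fv \<theta>)" for \<theta> l v
    proof -
      have vj: "v j \<in> level (Suc l) (n (Suc l))" if "j \<in> fv \<theta>" for j using v that by blast
      have "tr l (v j) \<in> level (Suc l) (n (Suc l))" if "j \<in> fv \<theta>" for j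
      proof -
        have "tr l (v j) \<in> level l (n (Suc l))" using vj[OF that] unfolding tr_in_level by (simp add: level_def)
        then show ?thesis using level_mono[of l "Suc l" "n (Suc l)" "n (Suc l)"] by auto
      qed
      then have "sat M (\<lambda>j. c (v j)) \<theta> \<longleftrightarrow> sat M (\<lambda>j. C (Suc l) (v j)) \<theta>"
        "sat M (\<lambda>j. c (tr l (v j))) \<theta> \<longleftrightarrow> sat M (\<lambda>j. C (Suc l) (tr l (v j))) \<theta>"
        using vj by (auto intro!: sat_cong cC)
      then show ?thesis using nx \<theta> v inj by blast
    qed
    show "\<exists>q\<in>level l (n (Suc l)). sat M (\<lambda>j. c ((v(x := q)) j)) \<theta>"
      if \<theta>: "Exi x \<theta> \<in> F (Suc l)" and v: "v ` (fv \<theta> - {x}) \<subseteq> level l (n l)"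
        and sat: "sat M (\<lambda>j. c (v j)) (Exi x \<theta>)" for x \<theta> l v
    proof -
      have vj: "c (v j) = C (Suc l) (v j)" if "j \<in> fv \<theta> - {x}" for j
        using v that lev[of l "Suc l"] by (intro cC) auto
      then have "sat M (\<lambda>j. C (Suc l) (v j)) (Exi x \<theta>)"
        using sat_cong[of "Exi x \<theta>" "\<lambda>j. c (v j)" "\<lambda>j. C (Suc l) (v j)" M] sat by simp
      then obtain q where q: "q \<in> level l (n (Suc l))" "sat M (\<lambda>j. C (Suc l) ((v(x := q)) j)) \<theta>"
        using nx \<theta> v by blast
      then have "q \<in> level (Suc l) (n (Suc l))"
        using level_mono[of l "Suc l" "n (Suc l)" "n (Suc l)"] by auto
      then have "sat M (\<lambda>j. c ((v(x := q)) j)) \<theta> \<longleftrightarrow> sat M (\<lambda>j. C (Suc l) ((v(x := q)) j)) \<theta>"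
        by (intro sat_cong) (auto simp: vj cC)
      then show ?thesis using q by blast
    qed
    show "\<exists>l0. \<forall>l\<ge>l0. \<forall>v. v ` {..<k} \<subseteq> level l (n l) \<longrightarrow>
      (\<exists>\<phi>\<in>p \<inter> F (Suc l). \<not> sat M (\<lambda>j. c (v j)) \<phi>)" if kp: "(k, p) \<in> \<Delta>" for k p
    proof -
      obtain l0 where "(k, p) \<in> D l0" using D(3) kp by blast
      then have Dl: "(k, p) \<in> D l" if "l \<ge> l0" for l using monoD[OF D(2) that] by blast
      have "\<exists>\<phi>\<in>p \<inter> F (Suc l). \<not> sat M (\<lambda>j. c (v j)) \<phi>"
        if l: "l \<ge> l0" and v: "v ` {..<k} \<subseteq> level l (n l)" for l v
      proof -
        obtain \<phi> where \<phi>: "\<phi> \<in> p \<inter> F (Suc l)" "\<not> sat M (\<lambda>j. C (Suc l) (v j)) \<phi>"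
          using nx[of l] Dl[OF l] v by blast
        have "fv \<phi> \<subseteq> {..<k}" using \<Delta>(2)[OF kp] \<phi> by (simp add: formula_def)
        then have "sat M (\<lambda>j. c (v j)) \<phi> \<longleftrightarrow> sat M (\<lambda>j. C (Suc l) (v j)) \<phi>"
          using v lev[of l "Suc l"] by (intro sat_cong cC) auto
        then show ?thesis using \<phi> by blast
      qed
      then show ?thesis by blast
    qed
  qed
  then show ?thesis by blast
qed

end

section \<open>The limit model\<close>

context approximation
begin

section \<open>Eventual truth along truncations\<close>

definition limit_true :: "('f, 'r) fm \<Rightarrow> (nat \<Rightarrow> cantor \<times> nat) \<Rightarrow> bool" where
  "limit_true \<theta> e \<longleftrightarrow> (\<forall>\<^sub>F l in sequentially. sat M (\<lambda>j. c (tr l (e j))) \<theta>)"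

text \<open>From level \<open>l\<close> on, the truth value of \<open>\<theta>\<close> at the approximations of \<open>e\<close> no longer changes.\<close>

definition settled :: "('f, 'r) fm \<Rightarrow> (nat \<Rightarrow> cantor \<times> nat) \<Rightarrow> nat \<Rightarrow> bool" where
  "settled \<theta> e l \<longleftrightarrow> \<theta> \<in> F (Suc l) \<and> (\<forall>j\<in>fv \<theta>. snd (e j) < n (Suc l)) \<and> inj_on (tr l) (e ` fv \<theta>)"

lemma F_wf: "\<theta> \<in> F l \<Longrightarrow> wf_fm L \<theta>"
  using F_exhaust by blast

lemma le_n: "l \<le> n l"
  using strict_mono_n by (rule strict_mono_imp_increasing)

lemma n_le: "l \<le> m \<Longrightarrow> n l \<le> n m"
  using strict_mono_n by (simp add: strict_mono_less_eq)

lemma eventually_less_n: "\<forall>\<^sub>F l in sequentially. i < n l"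
  unfolding eventually_sequentially using le_n by (metis Suc_le_lessD order_trans)

lemma eventually_F:
  assumes "wf_fm L \<theta>"
  shows "\<forall>\<^sub>F l in sequentially. \<theta> \<in> F l"
proof -
  obtain l0 where "\<theta> \<in> F l0" using F_exhaust assms by blast
  then show ?thesis unfolding eventually_sequentially using monoD[OF mono_F] by blast
qed

lemma eventually_settled:
  assumes "wf_fm L \<theta>"
  shows "\<forall>\<^sub>F l in sequentially. settled \<theta> e l"
proof -
  have "\<forall>\<^sub>F l in sequentially. \<theta> \<in> F (Suc l)"
    unfolding eventually_sequentially_Suc[of "\<lambda>l. \<theta> \<in> F l"] by (rule eventually_F[OF assms])
  moreover have "\<forall>\<^sub>F l in sequentially. \<forall>j\<in>fv \<theta>. snd (e j) < n (Suc l)"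
  proof (intro eventually_ball_finite ballI finite_fv)
    show "\<forall>\<^sub>F l in sequentially. snd (e j) < n (Suc l)" for j
      unfolding eventually_sequentially_Suc[of "\<lambda>l. snd (e j) < n l"] by (rule eventually_less_n)
  qed
  moreover have "\<forall>\<^sub>F l in sequentially. inj_on (tr l) (e ` fv \<theta>)"
    by (intro eventually_inj_on_tr finite_imageI finite_fv)
  ultimately show ?thesis unfolding settled_def by eventually_elim blast
qed

text \<open>From \<open>m\<close> to \<open>Suc m\<close> only one bit is added to each entry.
  Distinct entries already differ when cut to \<open>l\<close> bits, hence also to \<open>m\<close>
  bits, and \<open>coherent\<close> applies to the truncations to \<open>Suc m\<close> bits.\<close>

lemma sat_stable:
  assumes "settled \<theta> e l" "l \<le> m"
  shows "sat M (\<lambda>j. c (tr m (e j))) \<theta> \<longleftrightarrow> sat M (\<lambda>j. c (tr l (e j))) \<theta>"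
  using assms(2)
proof (induction m rule: dec_induct)
  case (step m)
  define v where "v = (\<lambda>j. tr (Suc m) (e j))"
  have trv: "tr m (v j) = tr m (e j)" for j by (simp add: v_def tr_tr)
  have "\<theta> \<in> F (Suc m)"
    using assms(1) monoD[OF mono_F, of "Suc l" "Suc m"] step.hyps by (auto simp: settled_def)
  moreover have "v ` fv \<theta> \<subseteq> level (Suc m) (n (Suc m))"
    using assms(1) n_le[of "Suc l" "Suc m"] step.hyps
    by (fastforce simp: v_def tr_in_level settled_def)
  moreover have "inj_on (tr m) (v ` fv \<theta>)"
  proof (rule inj_onI)
    fix p q assume "p \<in> v ` fv \<theta>" "q \<in> v ` fv \<theta>" and eq: "tr m p = tr m q"
    then obtain i j where ij: "i \<in> fv \<theta>" "j \<in> fv \<theta>" "p = v i" "q = v j" by blast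
    with eq have "tr m (e i) = tr m (e j)" by (simp add: trv)
    then have "tr l (e i) = tr l (e j)" using step.hyps by (intro tr_eq_mono[of l m]) auto
    then have "e i = e j" using assms(1) ij by (auto simp: settled_def dest: inj_onD)
    then show "p = q" using ij by (simp add: v_def)
  qed
  ultimately have "sat M (\<lambda>j. c (v j)) \<theta> \<longleftrightarrow> sat M (\<lambda>j. c (tr m (v j))) \<theta>"
    by (rule coherent)
  then show ?case using step.IH by (simp add: trv) (simp add: v_def)
qed simp

lemma limit_true_iff:
  assumes "settled \<theta> e l"
  shows "limit_true \<theta> e \<longleftrightarrow> sat M (\<lambda>j. c (tr l (e j))) \<theta>"
proof
  assume "limit_true \<theta> e"
  then obtain l0 where "\<And>m. m \<ge> l0 \<Longrightarrow> sat M (\<lambda>j. c (tr m (e j))) \<theta>"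
    unfolding limit_true_def eventually_sequentially by blast
  from this[of "max l l0"] show "sat M (\<lambda>j. c (tr l (e j))) \<theta>"
    using sat_stable[OF assms, of "max l l0"] by simp
next
  assume "sat M (\<lambda>j. c (tr l (e j))) \<theta>"
  then show "limit_true \<theta> e"
    unfolding limit_true_def eventually_sequentially using sat_stable[OF assms] by blast
qed

text \<open>Eventual constancy is essential here: at a level where both formulas are settled, not
  being eventually true amounts to being false.\<close>

lemma limit_true_Neg:
  assumes "wf_fm L \<theta>"
  shows "limit_true (Neg \<theta>) e \<longleftrightarrow> \<not> limit_true \<theta> e"
proof -
  have "\<forall>\<^sub>F l in sequentially. settled \<theta> e l \<and> settled (Neg \<theta>) e l"
    using assms by (intro eventually_conj eventually_settled) auto
  then obtain l where "settled \<theta> e l" "settled (Neg \<theta>) e l"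
    using eventually_happens'[OF sequentially_bot] by blast
  then show ?thesis by (simp add: limit_true_iff)
qed

lemma limit_true_Conj: "limit_true (Conj \<phi> \<psi>) e \<longleftrightarrow> limit_true \<phi> e \<and> limit_true \<psi> e"
  by (simp add: limit_true_def eventually_conj_iff)

text \<open>From left to right, a witness among the points of length \<open>l\<close> is lifted to a
  point of the limit at which \<theta> is settled. From right to left, the truncations of
  \<open>y\<close> give a witness in \<open>M\<close> at all large levels.\<close>

lemma limit_true_Exi:
  assumes "wf_fm L \<theta>"
  shows "limit_true (Exi x \<theta>) e \<longleftrightarrow> (\<exists>y. limit_true \<theta> (e(x := y)))"
proof
  assume limit_true: "limit_true (Exi x \<theta>) e"
  \<comment> \<open>Besides being settled, the columns must lie below \<open>n l\<close> rather than
    \<open>n (Suc l)\<close>, since \<open>witness\<close> takes its entries from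
    \<open>level l (n l)\<close>.\<close>
  have "\<forall>\<^sub>F l in sequentially. settled (Exi x \<theta>) e l \<and> \<theta> \<in> F l \<and> (\<forall>j\<in>fv \<theta>. snd (e j) < n l)"
    using assms finite_fv eventually_less_n
    by (intro eventually_conj eventually_settled eventually_F eventually_ball_finite ballI) auto
  then obtain l where l: "settled (Exi x \<theta>) e l" "\<theta> \<in> F l" and snd: "\<forall>j\<in>fv \<theta>. snd (e j) < n l"
    using eventually_happens'[OF sequentially_bot] by blast
  define v where "v = (\<lambda>j. tr l (e j))"
  have inj: "e i = e j" if "i \<in> fv \<theta> - {x}" "j \<in> fv \<theta> - {x}" "tr l (e i) = tr l (e j)" for i j
    using l(1) that by (auto simp: settled_def dest: inj_onD)
  have "sat M (\<lambda>j. c (v j)) (Exi x \<theta>)"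
    using limit_true limit_true_iff[OF l(1)] unfolding v_def by blast
  moreover have "v ` (fv \<theta> - {x}) \<subseteq> level l (n l)"
    using snd by (auto simp: v_def tr_in_level)
  moreover have "Exi x \<theta> \<in> F (Suc l)" using l(1) by (simp add: settled_def)
  ultimately obtain q where q: "q \<in> level l (n (Suc l))" "sat M (\<lambda>j. c ((v(x := q)) j)) \<theta>"
    using witness by blast
  \<comment> \<open>If the witness \<open>q\<close> is the truncation of an entry, that entry itself
    is taken, since otherwise two different entries could share a truncation and \<theta> would not
    be settled at \<open>l\<close>. If not, \<open>q\<close> serves.\<close>
  obtain y where y: "tr l y = q" "\<And>j. j \<in> fv \<theta> - {x} \<Longrightarrow> tr l (e j) = q \<Longrightarrow> y = e j"
  proof (cases "\<exists>i\<in>fv \<theta> - {x}. tr l (e i) = q")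
    case True
    then obtain i where "i \<in> fv \<theta> - {x}" "tr l (e i) = q" by blast
    then show ?thesis using inj by (intro that[of "e i"]) auto
  next
    case False
    then show ?thesis using tr_level[OF q(1)] by (intro that[of q]) auto
  qed
  define e' where "e' = e(x := y)"
  have "inj_on (tr l) (e' ` fv \<theta>)"
  proof (rule inj_onI)
    fix p r assume "p \<in> e' ` fv \<theta>" "r \<in> e' ` fv \<theta>" and eq: "tr l p = tr l r"
    then obtain i j where ij: "i \<in> fv \<theta>" "j \<in> fv \<theta>" "p = e' i" "r = e' j" by blast
    show "p = r"
    proof (cases "i = x"; cases "j = x")
      assume "i = x" "j \<noteq> x"
      then show ?thesis using ij eq y(1) y(2)[of j] by (simp add: e'_def)
    next
      assume "i \<noteq> x" "j = x"
      then show ?thesis using ij eq y(1) y(2)[of i] by (simp add: e'_def)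
    next
      assume "i \<noteq> x" "j \<noteq> x"
      then show ?thesis using ij eq inj[of i j] by (simp add: e'_def)
    qed (use ij in simp)
  qed
  moreover have "snd (e' j) < n (Suc l)" if "j \<in> fv \<theta>" for j
  proof (cases "j = x")
    case True
    then have "snd (e' j) = snd q" using y(1) by (auto simp: e'_def)
    then show ?thesis using q(1) by (simp add: level_def)
  next
    case False
    then have "snd (e' j) < n l" using snd that by (simp add: e'_def)
    then show ?thesis using n_le[of l "Suc l"] by simp
  qed
  moreover have "\<theta> \<in> F (Suc l)" using l(2) monoD[OF mono_F, of l "Suc l"] by auto
  ultimately have settled: "settled \<theta> e' l" by (simp add: settled_def)
  have "(\<lambda>j. c (tr l (e' j))) = (\<lambda>j. c ((v(x := q)) j))"
    using y(1) by (auto simp: e'_def v_def fun_eq_iff)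
  then have "limit_true \<theta> e'" using q(2) limit_true_iff[OF settled] by simp
  then show "\<exists>y. limit_true \<theta> (e(x := y))" unfolding e'_def by blast
next
  assume "\<exists>y. limit_true \<theta> (e(x := y))"
  then obtain y where "limit_true \<theta> (e(x := y))" by blast
  then have *: "\<forall>\<^sub>F l in sequentially. sat M (\<lambda>j. c (tr l ((e(x := y)) j))) \<theta>" by (simp add: limit_true_def)
  have "(\<lambda>j. c (tr l ((e(x := y)) j))) = (\<lambda>j. c (tr l (e j)))(x := c (tr l y))" for l
    by auto
  moreover have "c (tr l y) \<in> univ M" for l using c_range by blast
  ultimately have "sat M (\<lambda>j. c (tr l ((e(x := y)) j))) \<theta> \<Longrightarrow> sat M (\<lambda>j. c (tr l (e j))) (Exi x \<theta>)" for l
    unfolding sat.simps by metis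
  with * show "limit_true (Exi x \<theta>) e" unfolding limit_true_def by (rule eventually_mono)
qed

section \<open>The limit structure and truth in it\<close>

definition limit :: "('f, 'r, cantor \<times> nat) fo_struct" where
  "limit = \<lparr>univ = UNIV,
     fn = (\<lambda>f xs. SOME y. \<forall>\<^sub>F l in sequentially. c (tr l y) = fn M f (map (\<lambda>z. c (tr l z)) xs)),
     rl = (\<lambda>r xs. \<forall>\<^sub>F l in sequentially. rl M r (map (\<lambda>z. c (tr l z)) xs))\<rparr>"

lemma univ_limit [simp]: "univ limit = UNIV"
  by (simp add: limit_def)

lemma struct_limit: "is_struct L limit"
  by (simp add: is_struct_def)

lemma rl_limit:
  "rl limit r xs \<longleftrightarrow> (\<forall>\<^sub>F l in sequentially. rl M r (map (\<lambda>z. c (tr l z)) xs))"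
  by (simp add: limit_def)

text \<open>This justifies the choice in \<open>limit\<close>. The formula x_k = f(x_0, ...,
  x_(k-1)) has a solution for x_k in \<open>M\<close> at every level, because \<open>M\<close> is
  closed under \<open>f\<close>, so \<open>limit_true_Exi\<close> yields a point solving it in the
  limit.\<close>

lemma fn_limit:
  assumes "f \<in> funs L" "length xs = fun_ar L f"
  shows "\<forall>\<^sub>F l in sequentially. c (tr l (fn limit f xs)) = fn M f (map (\<lambda>z. c (tr l z)) xs)"
proof -
  define k where "k = length xs"
  define \<theta> where "\<theta> = (Eq (Var k) (App f (map Var [0..<k])) :: ('f, 'r) fm)"
  define e where "e = (\<lambda>j. xs ! j)"
  have wf: "wf_fm L \<theta>" using assms by (auto simp: \<theta>_def k_def)
  have val: "map (val M e') (map Var [0..<k]) = map e' [0..<k]" for e' :: "nat \<Rightarrow> 'a" by simp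
  have xs: "map (\<lambda>j. c (tr l ((e(k := y)) j))) [0..<k] = map (\<lambda>z. c (tr l z)) xs" for l y
    by (intro nth_equalityI) (auto simp: e_def k_def)
  have "sat M (\<lambda>j. c (tr l (e j))) (Exi k \<theta>)" for l
  proof -
    define a where "a = fn M f (map (\<lambda>z. c (tr l z)) xs)"
    have "a \<in> univ M"
      using struct assms range_subsetD[OF c_range] unfolding is_struct_def a_def by (auto simp: image_subset_iff)
    moreover have "map ((\<lambda>j. c (tr l (e j)))(k := a)) [0..<k] = map (\<lambda>z. c (tr l z)) xs"
      by (intro nth_equalityI) (auto simp: e_def k_def)
    then have "sat M ((\<lambda>j. c (tr l (e j)))(k := a)) \<theta>"
      unfolding \<theta>_def sat.simps val.simps val by (simp add: a_def)
    ultimately show ?thesis by auto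
  qed
  then have "limit_true (Exi k \<theta>) e" by (simp add: limit_true_def)
  then obtain y where "limit_true \<theta> (e(k := y))" using limit_true_Exi[OF wf] by blast
  then have "\<forall>\<^sub>F l in sequentially. c (tr l y) = fn M f (map (\<lambda>z. c (tr l z)) xs)"
    unfolding limit_true_def \<theta>_def sat.simps val.simps val xs by simp
  then show ?thesis unfolding limit_def fo_struct.simps by (rule someI)
qed

lemma val_limit:
  "wf_tm L t \<Longrightarrow>
    \<forall>\<^sub>F l in sequentially. c (tr l (val limit e t)) = val M (\<lambda>j. c (tr l (e j))) t"
proof (induction t)
  case (App f ts)
  have "\<forall>\<^sub>F l in sequentially. \<forall>t\<in>set ts. c (tr l (val limit e t)) = val M (\<lambda>j. c (tr l (e j))) t"
    using App by (intro eventually_ball_finite) auto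
  moreover have "\<forall>\<^sub>F l in sequentially. c (tr l (fn limit f (map (val limit e) ts))) =
      fn M f (map (\<lambda>z. c (tr l z)) (map (val limit e) ts))"
    using App.prems by (intro fn_limit) auto
  ultimately show ?case
  proof eventually_elim
    case (elim l)
    then have "map (\<lambda>z. c (tr l z)) (map (val limit e) ts) = map (val M (\<lambda>j. c (tr l (e j)))) ts"
      by simp
    with elim(2) show ?case by (simp only: val.simps)
  qed
qed simp

text \<open>Equality in the limit is thereby genuine equality of points, without passing to a
  quotient: truncations of distinct points become distinct, and \<open>c\<close> is injective on
  each level.\<close>

lemma eventually_c_neq:
  assumes "y \<noteq> z"
  shows "\<forall>\<^sub>F l in sequentially. c (tr l y) \<noteq> c (tr l z)"
proof -
  have "\<forall>\<^sub>F l in sequentially. inj_on (tr l) {y, z}" by (intro eventually_inj_on_tr) simp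
  then show ?thesis
    using eventually_less_n[of "snd y"] eventually_less_n[of "snd z"]
  proof eventually_elim
    case (elim l)
    then have "tr l y \<noteq> tr l z" using assms by auto
    then show ?case
      using c_inj[of l] elim(2,3) by (auto simp: tr_in_level dest: inj_onD)
  qed
qed

text \<open>The analogue of the theorem of Los for eventual truth. An equation that holds eventually
  holds in the limit by \<open>eventually_c_neq\<close>; the quantifier step is
  \<open>limit_true_Exi\<close>.\<close>

lemma sat_limit: "wf_fm L \<theta> \<Longrightarrow> sat limit e \<theta> \<longleftrightarrow> limit_true \<theta> e"
proof (induction \<theta> arbitrary: e)
  case (Eq s t)
  have v: "\<forall>\<^sub>F l in sequentially. c (tr l (val limit e s)) = val M (\<lambda>j. c (tr l (e j))) s"
    "\<forall>\<^sub>F l in sequentially. c (tr l (val limit e t)) = val M (\<lambda>j. c (tr l (e j))) t"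
    using Eq by (auto intro: val_limit)
  show ?case
  proof
    assume "sat limit e (Eq s t)"
    then have "val limit e s = val limit e t" by simp
    then show "limit_true (Eq s t) e"
      unfolding limit_true_def using v by (auto elim: eventually_elim2)
  next
    assume "limit_true (Eq s t) e"
    then have *: "\<forall>\<^sub>F l in sequentially. val M (\<lambda>j. c (tr l (e j))) s = val M (\<lambda>j. c (tr l (e j))) t"
      by (simp add: limit_true_def)
    show "sat limit e (Eq s t)"
    proof (rule ccontr)
      assume "\<not> sat limit e (Eq s t)"
      then have "\<forall>\<^sub>F l in sequentially. c (tr l (val limit e s)) \<noteq> c (tr l (val limit e t))"
        by (intro eventually_c_neq) simp
      with * v have "\<forall>\<^sub>F l in sequentially. False" by eventually_elim simp
      then show False by simp
    qed
  qed
next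
  case (Rel r ts)
  have "\<forall>\<^sub>F l in sequentially. \<forall>t\<in>set ts. c (tr l (val limit e t)) = val M (\<lambda>j. c (tr l (e j))) t"
    using Rel val_limit by (intro eventually_ball_finite) auto
  then have "\<forall>\<^sub>F l in sequentially. rl M r (map (\<lambda>z. c (tr l z)) (map (val limit e) ts)) \<longleftrightarrow>
      sat M (\<lambda>j. c (tr l (e j))) (Rel r ts)"
  proof eventually_elim
    case (elim l)
    then have "map (\<lambda>z. c (tr l z)) (map (val limit e) ts) = map (val M (\<lambda>j. c (tr l (e j)))) ts"
      by simp
    then show ?case by (simp only: sat.simps)
  qed
  then show ?case
    unfolding limit_true_def sat.simps(2)[of limit] rl_limit by (rule eventually_subst)
next
  case (Neg \<theta>)
  then show ?case using limit_true_Neg[of \<theta> e] by simp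
next
  case (Conj \<phi> \<psi>)
  then show ?case using limit_true_Conj[of \<phi> \<psi> e] by simp
next
  case (Exi x \<theta>)
  then show ?case using limit_true_Exi[of \<theta> x e] by simp
qed

text \<open>The common source of asymptotic similarity and of the topological and measure-theoretic
  properties. Both tuples are settled at \<open>l\<close> and have the same truncations. Only
  equalities among the entries of \<open>e\<close> must be assumed to persist: unequal entries
  already have unequal truncations.\<close>

lemma sat_limit_agree:
  assumes l: "settled \<theta> e l"
    and tr: "\<And>j. j \<in> fv \<theta> \<Longrightarrow> tr l (e' j) = tr l (e j)"
    and eq: "\<And>i j. i \<in> fv \<theta> \<Longrightarrow> j \<in> fv \<theta> \<Longrightarrow> e i = e j \<Longrightarrow> e' i = e' j"
  shows "sat limit e' \<theta> \<longleftrightarrow> sat limit e \<theta>"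
proof -
  have "inj_on (tr l) (e' ` fv \<theta>)"
  proof (rule inj_onI)
    fix p q assume "p \<in> e' ` fv \<theta>" "q \<in> e' ` fv \<theta>" "tr l p = tr l q"
    then obtain i j where ij: "i \<in> fv \<theta>" "j \<in> fv \<theta>" "p = e' i" "q = e' j" "tr l (e' i) = tr l (e' j)"
      by blast
    then have "tr l (e i) = tr l (e j)" using tr by simp
    then have "e i = e j" using l ij by (auto simp: settled_def dest: inj_onD)
    then show "p = q" using eq[OF ij(1,2)] ij(3,4) by simp
  qed
  moreover have "snd (e' j) = snd (e j)" if "j \<in> fv \<theta>" for j
    using tr[OF that] by (simp add: tr_eq_iff)
  ultimately have l': "settled \<theta> e' l" using l by (simp add: settled_def)
  have "wf_fm L \<theta>" using l F_wf by (auto simp: settled_def)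
  moreover have "sat M (\<lambda>j. c (tr l (e' j))) \<theta> \<longleftrightarrow> sat M (\<lambda>j. c (tr l (e j))) \<theta>"
    by (rule sat_cong) (simp add: tr)
  ultimately show ?thesis using limit_true_iff[OF l] limit_true_iff[OF l'] by (simp add: sat_limit)
qed

section \<open>Elementary equivalence, omitted types and atomicity\<close>

lemma elem_equiv_limit: "elem_equiv L M limit"
proof -
  have "(\<forall>e. range e \<subseteq> univ M \<longrightarrow> sat M e \<sigma>) \<longleftrightarrow> (\<forall>e. range e \<subseteq> univ limit \<longrightarrow> sat limit e \<sigma>)"
    if \<sigma>: "formula L 0 \<sigma>" for \<sigma>
  proof -
    \<comment> \<open>The truth of a sentence does not depend on the assignment, so it is the same
      at every level of the approximation.\<close>
    have cong: "sat M e \<sigma> \<longleftrightarrow> sat M e' \<sigma>" for e e'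
      using \<sigma> by (intro sat_cong) (simp add: formula_def)
    have "limit_true \<sigma> e' \<longleftrightarrow> sat M e \<sigma>" for e e'
    proof -
      have "sat M (\<lambda>j. c (tr l (e' j))) \<sigma> \<longleftrightarrow> sat M e \<sigma>" for l by (rule cong)
      then show ?thesis by (simp add: limit_true_def)
    qed
    moreover obtain u where "u \<in> univ M" using struct by (auto simp: is_struct_def)
    then have "range (\<lambda>_::nat. u) \<subseteq> univ M" by auto
    moreover have "sat limit e \<sigma> \<longleftrightarrow> limit_true \<sigma> e" for e
      using \<sigma> by (simp add: sat_limit formula_def)
    ultimately show ?thesis by (metis cong subset_UNIV univ_limit)
  qed
  then show ?thesis by (auto simp: elem_equiv_def Th_def)
qed

text \<open>The level is fixed before the falsified formula is known: once all entries of
  \<open>x\<close> are separated and their columns are present, every formula of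
  \<open>F (Suc l)\<close> in the variables below \<open>k\<close> is settled. The member of
  \<open>p\<close> supplied by \<open>omit\<close> is therefore false in the limit.\<close>

lemma omits_limit:
  assumes kp: "(k, p) \<in> \<Delta>" and p: "\<And>\<phi>. \<phi> \<in> p \<Longrightarrow> formula L k \<phi>"
  shows "omits limit k p"
  unfolding omits_def
proof
  assume "\<exists>x\<in>{..<k} \<rightarrow>\<^sub>E univ limit. \<forall>\<phi>\<in>p. sat limit x \<phi>"
  then obtain x where x: "\<And>\<phi>. \<phi> \<in> p \<Longrightarrow> sat limit x \<phi>" by blast
  have "\<forall>\<^sub>F l in sequentially. \<forall>v. v ` {..<k} \<subseteq> level l (n l) \<longrightarrow>
      (\<exists>\<phi>\<in>p \<inter> F (Suc l). \<not> sat M (\<lambda>j. c (v j)) \<phi>)"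
    unfolding eventually_sequentially by (rule omit[OF kp])
  moreover have "\<forall>\<^sub>F l in sequentially. \<forall>j\<in>{..<k}. snd (x j) < n l"
    using eventually_less_n by (intro eventually_ball_finite) auto
  moreover have "\<forall>\<^sub>F l in sequentially. inj_on (tr l) (x ` {..<k})"
    by (intro eventually_inj_on_tr) auto
  ultimately have "\<forall>\<^sub>F l in sequentially. False"
  proof eventually_elim
    case (elim l)
    have "(\<lambda>j. tr l (x j)) ` {..<k} \<subseteq> level l (n l)"
      using elim(2) by (auto simp: tr_in_level)
    then obtain \<phi> where \<phi>: "\<phi> \<in> p" "\<phi> \<in> F (Suc l)" "\<not> sat M (\<lambda>j. c (tr l (x j))) \<phi>"
      using elim(1) by blast
    have fv: "fv \<phi> \<subseteq> {..<k}" using p[OF \<phi>(1)] by (simp add: formula_def)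
    have "settled \<phi> x l"
      unfolding settled_def
    proof (intro conjI ballI)
      show "snd (x j) < n (Suc l)" if "j \<in> fv \<phi>" for j
        using elim(2) fv that n_le[of l "Suc l"] by (meson le_SucI order_less_le_trans order_refl subsetD)
      show "inj_on (tr l) (x ` fv \<phi>)"
        using elim(3) fv by (meson image_mono inj_on_subset)
    qed (rule \<phi>(2))
    then show ?case using limit_true_iff[of \<phi> x l] \<phi> x[OF \<phi>(1)] sat_limit[OF F_wf[OF \<phi>(2)]] by blast
  qed
  then show False by simp
qed

text \<open>An implication valid in \<open>M\<close> holds at all levels of the approximation and
  hence in the limit. It is applied to the implications from \<phi> to \<psi> and to its
  negation.\<close>

lemma complete_formula_limit:
  assumes \<phi>: "complete_formula L M k \<phi>" and x: "x \<in> {..<k} \<rightarrow>\<^sub>E univ limit" "sat limit x \<phi>"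
  shows "complete_formula L limit k \<phi>"
proof -
  have transfer: "sat limit y \<psi>"
    if M: "\<forall>x\<in>{..<k} \<rightarrow>\<^sub>E univ M. sat M x \<phi> \<longrightarrow> sat M x \<psi>" and \<psi>: "formula L k \<psi>" and y: "sat limit y \<phi>" for y \<psi>
  proof -
    have step: "sat M (\<lambda>j. c (tr l (y j))) \<psi>" if "sat M (\<lambda>j. c (tr l (y j))) \<phi>" for l
    proof -
      have res: "sat M (\<lambda>j\<in>{..<k}. c (tr l (y j))) \<psi> \<longleftrightarrow> sat M (\<lambda>j. c (tr l (y j))) \<psi>"
        if "formula L k \<psi>" for \<psi>
        using that by (intro sat_cong) (auto simp: formula_def)
      have "formula L k \<phi>" using \<phi> by (simp add: complete_formula_def)
      moreover have "(\<lambda>j\<in>{..<k}. c (tr l (y j))) \<in> {..<k} \<rightarrow>\<^sub>E univ M" using c_range by auto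
      ultimately show ?thesis using M res[of \<phi>] res[OF \<psi>] that by blast
    qed
    have "limit_true \<psi> y" if "limit_true \<phi> y"
      using that unfolding limit_true_def by (rule eventually_mono) (rule step)
    then show ?thesis using y \<psi> \<phi> by (simp add: sat_limit formula_def complete_formula_def)
  qed
  show ?thesis
    unfolding complete_formula_def
  proof (intro conjI allI impI)
    show "formula L k \<phi>" using \<phi> by (simp add: complete_formula_def)
    show "\<exists>x\<in>{..<k} \<rightarrow>\<^sub>E univ limit. sat limit x \<phi>" using x by blast
    fix \<psi> assume \<psi>: "formula L k \<psi>"
    then have "formula L k (Neg \<psi>)" by (simp add: formula_def)
    with \<phi> \<psi> show "(\<forall>x\<in>{..<k} \<rightarrow>\<^sub>E univ limit. sat limit x \<phi> \<longrightarrow> sat limit x \<psi>) \<or>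
        (\<forall>x\<in>{..<k} \<rightarrow>\<^sub>E univ limit. sat limit x \<phi> \<longrightarrow> \<not> sat limit x \<psi>)"
      using transfer[of \<psi>] transfer[of "Neg \<psi>"] unfolding complete_formula_def by auto
  qed
qed

lemma atomic_limit:
  assumes "\<And>k. (k, Neg ` {\<phi>. complete_formula L M k \<phi>}) \<in> \<Delta>"
  shows "atomic L limit"
  unfolding atomic_def
proof (intro allI ballI)
  fix k :: nat and x assume x: "x \<in> {..<k} \<rightarrow>\<^sub>E univ limit"
  have "omits limit k (Neg ` {\<phi>. complete_formula L M k \<phi>})"
    by (rule omits_limit[OF assms]) (auto simp: complete_formula_def formula_def)
  then obtain \<phi> where "complete_formula L M k \<phi>" "sat limit x \<phi>"
    using x by (auto simp: omits_def)
  then show "\<exists>\<phi>. complete_formula L limit k \<phi> \<and> sat limit x \<phi>"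
    using complete_formula_limit x by blast
qed

section \<open>Asymptotic similarity and local constancy of truth\<close>

lemma asymptotically_similar_limit: "asymptotically_similar L limit (\<lambda>\<eta>. (\<eta>, i))"
  unfolding asymptotically_similar_def
proof (intro allI impI)
  fix k \<theta> assume \<theta>: "formula L k \<theta>"
  then have "wf_fm L \<theta>" by (simp add: formula_def)
  \<comment> \<open>The bound depends only on \<theta> and on the one column \<open>i\<close> of all
    entries. The remaining requirement of \<open>settled\<close>, that entries be separated by their
    first \<open>l\<close> bits, is part of \<open>similar_mod\<close>.\<close>
  then have "\<forall>\<^sub>F l in sequentially. \<theta> \<in> F l \<and> i < n l"
    by (intro eventually_conj eventually_F eventually_less_n)
  then obtain l0 where l0: "\<And>l. l \<ge> l0 \<Longrightarrow> \<theta> \<in> F l \<and> i < n l"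
    unfolding eventually_sequentially by blast
  have "sat limit (\<lambda>j. (\<eta> j, i)) \<theta> \<longleftrightarrow> sat limit (\<lambda>j. (\<tau> j, i)) \<theta>"
    if l: "l \<ge> l0" and sim: "similar_mod k l \<eta> \<tau>" for l \<eta> \<tau>
  proof -
    have restr: "restrict \<eta> {..<l} = restrict \<tau> {..<l} \<longleftrightarrow> tr l (\<eta>, i) = tr l (\<tau>, i)" for \<eta> \<tau> :: cantor
      by (auto simp: tr_eq_iff restrict_def fun_eq_iff)
    have fv: "j < k" if "j \<in> fv \<theta>" for j using \<theta> that by (auto simp: formula_def)
    have "inj_on (tr l) ((\<lambda>j. (\<eta> j, i)) ` fv \<theta>)"
    proof (rule inj_onI)
      fix p q assume "p \<in> (\<lambda>j. (\<eta> j, i)) ` fv \<theta>" "q \<in> (\<lambda>j. (\<eta> j, i)) ` fv \<theta>" "tr l p = tr l q"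
      then obtain a b where ab: "a \<in> fv \<theta>" "b \<in> fv \<theta>" "p = (\<eta> a, i)" "q = (\<eta> b, i)"
        "restrict (\<eta> a) {..<l} = restrict (\<eta> b) {..<l}"
        using restr by blast
      have "inj_on (\<lambda>j. restrict (\<eta> j) {..<l}) {..<k}" using sim by (simp add: similar_mod_def)
      from inj_onD[OF this ab(5)] have "a = b" using fv ab by simp
      then show "p = q" using ab by simp
    qed
    then have settled: "settled \<theta> (\<lambda>j. (\<eta> j, i)) l" using l0[of "Suc l"] l by (simp add: settled_def)
    have "sat limit (\<lambda>j. (\<tau> j, i)) \<theta> \<longleftrightarrow> sat limit (\<lambda>j. (\<eta> j, i)) \<theta>"
    proof (rule sat_limit_agree[OF settled])
      show "tr l (\<tau> j, i) = tr l (\<eta> j, i)" if "j \<in> fv \<theta>" for j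
        using sim fv[OF that] restr[of "\<eta> j" "\<tau> j"] by (simp add: similar_mod_def)
      show "(\<tau> a, i) = (\<tau> b, i)" if "a \<in> fv \<theta>" "b \<in> fv \<theta>" "(\<eta> a, i) = (\<eta> b, i)" for a b
      proof -
        have "inj_on \<eta> {..<k}" using sim by (simp add: similar_mod_def)
        then have "a = b" using fv that by (auto dest: inj_onD)
        then show ?thesis by simp
      qed
    qed
    then show ?thesis by blast
  qed
  then show "\<exists>l0. \<forall>l\<ge>l0. \<forall>\<eta> \<tau>. similar_mod k l \<eta> \<tau> \<longrightarrow>
      (sat limit (\<lambda>j. (\<eta> j, i)) \<theta> \<longleftrightarrow> sat limit (\<lambda>j. (\<tau> j, i)) \<theta>)" by blast
qed

lemma sat_limit_locally_constant:
  assumes "formula L k \<phi>"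
  shows "\<exists>l. \<forall>e'. (\<forall>j<k. tr l (e' j) = tr l (e j)) \<longrightarrow>
    (\<forall>i<k. \<forall>j<k. e i = e j \<longrightarrow> e' i = e' j) \<longrightarrow> (sat limit e' \<phi> \<longleftrightarrow> sat limit e \<phi>)"
proof -
  have "\<forall>\<^sub>F l in sequentially. settled \<phi> e l"
    using assms by (intro eventually_settled) (simp add: formula_def)
  then obtain l where l: "settled \<phi> e l" using eventually_happens'[OF sequentially_bot] by blast
  have fv: "j < k" if "j \<in> fv \<phi>" for j using assms that by (auto simp: formula_def)
  show ?thesis
  proof (intro exI[of _ l] allI impI)
    fix e' assume e': "\<forall>j<k. tr l (e' j) = tr l (e j)" "\<forall>i<k. \<forall>j<k. e i = e j \<longrightarrow> e' i = e' j"
    show "sat limit e' \<phi> \<longleftrightarrow> sat limit e \<phi>"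
      by (rule sat_limit_agree[OF l]) (use fv e' in blast)+
  qed
qed

end

section \<open>Topology and measure\<close>

lemma boolean_combinations_subset: "A \<in> boolean_combinations X \<Longrightarrow> A \<subseteq> topspace X"
  by (induction rule: boolean_combinations.induct) (auto dest: openin_subset)

lemma boolean_combinations_Int:
  assumes "A \<in> boolean_combinations X" "B \<in> boolean_combinations X"
  shows "A \<inter> B \<in> boolean_combinations X"
proof -
  have "topspace X - ((topspace X - A) \<union> (topspace X - B)) \<in> boolean_combinations X"
    using assms by (intro boolean_combinations.intros(2,3))
  moreover have "topspace X - ((topspace X - A) \<union> (topspace X - B)) = A \<inter> B"
    using assms boolean_combinations_subset by blast
  ultimately show ?thesis by simp
qed

lemma boolean_combinations_finite_UN:
  assumes "finite I" "\<And>i. i \<in> I \<Longrightarrow> A i \<in> boolean_combinations X"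
  shows "(\<Union>i\<in>I. A i) \<in> boolean_combinations X"
  using assms
proof (induction I rule: finite_induct)
  case empty
  show ?case using boolean_combinations.intros(1)[OF openin_empty] by simp
next
  case (insert i I)
  then show ?case by (auto intro: boolean_combinations.intros(3))
qed

section \<open>Fibres of truncation as basic open sets, and boxes in powers\<close>

lemma tr_fibre: "{z. tr l z = tr l w} = cylinder (map (fst w) [0..<l]) \<times> {snd w}"
  by (auto simp: tr_eq_iff cylinder_def)

lemma open_tr_fibre: "open {z. tr l z = tr l w}"
  unfolding tr_fibre by (intro open_Times open_cylinder Topological_Spaces.open_discrete)

lemma emeasure_tr_fibre_pos: "emeasure mu {z. tr l z = tr l w} > 0"
proof -
  have "(1 / 2 :: ennreal) \<noteq> 0" by (simp add: ennreal_divide_eq_0_iff)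
  then have "(1 / 2 :: ennreal) ^ m \<noteq> 0" for m by (rule power_not_zero)
  then show ?thesis unfolding tr_fibre emeasure_mu by (simp only: zero_less_iff_neq_zero) blast
qed

lemma open_contains_tr_fibre:
  assumes "open W" "z \<in> W"
  obtains l where "{z'. tr l z' = tr l z} \<subseteq> W"
proof -
  obtain B where B: "B \<in> range (\<lambda>(s, i). cylinder s \<times> {i :: nat})" "z \<in> B" "B \<subseteq> W"
    by (rule topological_basisE[OF cylinder_basis assms])
  then obtain s i where "B = cylinder s \<times> {i}" by auto
  then have "{z'. tr (length s) z' = tr (length s) z} \<subseteq> B"
    using B(2) by (auto simp: tr_eq_iff cylinder_def mem_Times_iff)
  then show ?thesis using that B(3) by blast
qed

abbreviation (input) cantor_power :: "nat \<Rightarrow> (nat \<Rightarrow> cantor \<times> nat) topology" where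
  "cantor_power k \<equiv> product_topology (\<lambda>_. euclidean) {..<k}"

definition box :: "nat \<Rightarrow> nat \<Rightarrow> (nat \<Rightarrow> cantor \<times> nat) \<Rightarrow> (nat \<Rightarrow> cantor \<times> nat) set" where
  "box k l w = (\<Pi>\<^sub>E j\<in>{..<k}. {z. tr l z = tr l (w j)})"

lemma mem_box_iff: "p \<in> box k l w \<longleftrightarrow> p \<in> {..<k} \<rightarrow>\<^sub>E UNIV \<and> (\<forall>j<k. tr l (p j) = tr l (w j))"
  by (auto simp: box_def PiE_iff)

lemma openin_box: "openin (cantor_power k) (box k l w)"
  unfolding box_def by (simp add: openin_PiE open_tr_fibre)

lemma openin_contains_box:
  assumes U: "openin (cantor_power k) U" and p: "p \<in> U"
  obtains l where "box k l p \<subseteq> U"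
proof -
  obtain X where X: "p \<in> Pi\<^sub>E {..<k} X" "\<And>i. open (X i)" "Pi\<^sub>E {..<k} X \<subseteq> U"
    using product_topology_open_contains_basis[OF U p] by auto
  have "\<exists>l. {z. tr l z = tr l (p j)} \<subseteq> X j" if "j < k" for j
  proof -
    have "p j \<in> X j" using X(1) that by auto
    then show ?thesis using open_contains_tr_fibre[OF X(2)] by metis
  qed
  then obtain l where l: "\<And>j. j < k \<Longrightarrow> {z. tr (l j) z = tr (l j) (p j)} \<subseteq> X j" by metis
  \<comment> \<open>A common depth for all coordinates.\<close>
  define l' where "l' = Max (l ` {..<k})"
  have "q \<in> U" if q: "q \<in> box k l' p" for q
  proof -
    have "q j \<in> X j" if "j < k" for j
    proof -
      have "l j \<le> l'" using that by (simp add: l'_def)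
      then have "tr (l j) (q j) = tr (l j) (p j)"
        using q that by (intro tr_eq_mono[of "l j" l']) (simp_all add: mem_box_iff)
      then show ?thesis using l[OF that] by auto
    qed
    then have "q \<in> Pi\<^sub>E {..<k} X" using q by (auto simp: mem_box_iff PiE_iff)
    then show ?thesis using X(3) by blast
  qed
  then show ?thesis by (intro that[of l']) blast
qed

section \<open>Measure of boxes and measurability of open sets\<close>

lemma prob_space_mu: "prob_space mu"
  unfolding mu_def by (intro prob_space_pair prob_space_PiM measure_pmf.prob_space_axioms)

lemma box_sets: "box k l w \<in> sets (\<Pi>\<^sub>M j\<in>{..<k}. mu)"
  unfolding box_def by (intro sets_PiM_I_finite) (simp_all add: sets_mu open_tr_fibre)

lemma emeasure_box_pos: "emeasure (\<Pi>\<^sub>M j\<in>{..<k}. mu) (box k l w) > 0"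
proof -
  interpret prob_space mu by (rule prob_space_mu)
  interpret product_sigma_finite "\<lambda>_::nat. mu" by unfold_locales
  have "emeasure (\<Pi>\<^sub>M j\<in>{..<k}. mu) (box k l w) = (\<Prod>j<k. emeasure mu {z. tr l z = tr l (w j)})"
    unfolding box_def by (intro emeasure_PiM) (simp_all add: sets_mu open_tr_fibre)
  also have "\<dots> \<noteq> 0"
    using emeasure_tr_fibre_pos by (simp add: prod_zero_iff zero_less_iff_neq_zero)
  finally show ?thesis by (simp add: zero_less_iff_neq_zero)
qed

lemma countable_range_tr: "countable (range (tr l))"
proof -
  have "range (tr l) \<subseteq> (\<Union>n. level l n)"
    unfolding image_subset_iff UN_iff tr_in_level using lessI by blast
  moreover have "countable (\<Union>n. level l n)"
    by (intro countable_UN countable_finite[OF finite_level]) auto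
  ultimately show ?thesis by (rule countable_subset)
qed

text \<open>Open sets of the power have to be shown measurable in the product \<sigma>-algebra,
  which is generated by rectangles. A box does not change when its centre is truncated to the same
  depth, so there are only countably many boxes, and an open set is the union of those it
  contains.\<close>

lemma openin_sets:
  assumes U: "openin (cantor_power k) U"
  shows "U \<in> sets (\<Pi>\<^sub>M j\<in>{..<k}. mu)"
proof -
  define \<B> where "\<B> = {B \<in> (\<Union>l. box k l ` ({..<k} \<rightarrow>\<^sub>E range (tr l))). B \<subseteq> U}"
  have "countable (\<Union>l. box k l ` ({..<k} \<rightarrow>\<^sub>E range (tr l)))"
    by (intro countable_UN countable_image countable_PiE countable_range_tr) auto
  then have "countable \<B>" by (rule countable_subset[rotated]) (auto simp: \<B>_def)
  moreover have "\<B> \<subseteq> sets (\<Pi>\<^sub>M j\<in>{..<k}. mu)" using box_sets by (auto simp: \<B>_def)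
  ultimately have "\<Union>\<B> \<in> sets (\<Pi>\<^sub>M j\<in>{..<k}. mu)" by (rule sets.countable_Union)
  moreover have "U \<subseteq> \<Union>\<B>"
  proof
    fix p assume p: "p \<in> U"
    obtain l where l: "box k l p \<subseteq> U" by (rule openin_contains_box[OF U p])
    define w where "w = (\<lambda>j\<in>{..<k}. tr l (p j))"
    have w: "w \<in> {..<k} \<rightarrow>\<^sub>E range (tr l)" by (auto simp: w_def)
    have "box k l w = box k l p" by (auto simp: mem_box_iff w_def tr_tr)
    moreover have "p \<in> box k l p" using openin_subset[OF U] p by (auto simp: mem_box_iff)
    ultimately show "p \<in> \<Union>\<B>" using l w unfolding \<B>_def by blast
  qed
  then have "U = \<Union>\<B>" by (auto simp: \<B>_def)
  ultimately show ?thesis by simp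
qed

lemma boolean_combinations_sets:
  "A \<in> boolean_combinations (cantor_power k) \<Longrightarrow> A \<in> sets (\<Pi>\<^sub>M j\<in>{..<k}. mu)"
proof (induction rule: boolean_combinations.induct)
  case (2 A)
  have "topspace (cantor_power k) \<in> sets (\<Pi>\<^sub>M j\<in>{..<k}. mu)" by (intro openin_sets openin_topspace)
  then show ?case using 2 by (intro sets.Diff)
qed (auto intro: openin_sets)

lemma join_tr:
  assumes "\<forall>j<k. tr l (p j) = tr l (q j)"
  shows "tr l (join k p b i) = tr l (join k q b i)"
  using assms by (simp add: join_def)

text \<open>The coincidence sets \<open>P R\<close> are closed, and \<open>D\<close> is relatively open in \<open>P R\<close> near those of
  its points whose equality pattern is exactly \<open>R\<close>.\<close>

lemma boolean_combination_locally_constant: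
  fixes D :: "(nat \<Rightarrow> cantor \<times> nat) set" and K :: nat and b :: "nat \<Rightarrow> cantor \<times> nat"
  assumes D: "D \<subseteq> {..<k} \<rightarrow>\<^sub>E UNIV"
    and const: "\<And>p. p \<in> D \<Longrightarrow> \<exists>l. \<forall>q\<in>box k l p.
      (\<forall>i<K. \<forall>j<K. join k p b i = join k p b j \<longrightarrow> join k q b i = join k q b j) \<longrightarrow> q \<in> D"
  shows "D \<in> boolean_combinations (cantor_power k)"
proof -
  define P where "P R = {p \<in> {..<k} \<rightarrow>\<^sub>E UNIV. \<forall>(i, j)\<in>R. join k p b i = join k p b j}" for R
  define W where "W R = \<Union>{U. openin (cantor_power k) U \<and> U \<inter> P R \<subseteq> D}" for R
  have top: "topspace (cantor_power k) = {..<k} \<rightarrow>\<^sub>E UNIV" by simp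
  have "openin (cantor_power k) (topspace (cantor_power k) - P R)" for R
  proof (subst openin_subopen, rule ballI)
    fix p assume p: "p \<in> topspace (cantor_power k) - P R"
    then obtain i j where ij: "(i, j) \<in> R" "join k p b i \<noteq> join k p b j"
      by (auto simp: P_def)
    \<comment> \<open>Unequal entries are separated at some depth, and they stay unequal throughout
      the box of that depth.\<close>
    then obtain l where "inj_on (tr l) {join k p b i, join k p b j}"
      using eventually_happens'[OF sequentially_bot
          eventually_inj_on_tr[of "{join k p b i, join k p b j}"]] by auto
    then have l: "tr l (join k p b i) \<noteq> tr l (join k p b j)" using ij(2) by auto
    have "q \<in> topspace (cantor_power k) - P R" if q: "q \<in> box k l p" for q
    proof -
      have "\<forall>j<k. tr l (q j) = tr l (p j)" using q by (simp add: mem_box_iff)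
      from l join_tr[OF this, of b i] join_tr[OF this, of b j]
      have "join k q b i \<noteq> join k q b j" by auto
      then show ?thesis using q ij(1) by (auto simp: mem_box_iff P_def)
    qed
    then show "\<exists>U. openin (cantor_power k) U \<and> p \<in> U \<and> U \<subseteq> topspace (cantor_power k) - P R"
      using p openin_box by (intro exI[of _ "box k l p"]) (auto simp: mem_box_iff)
  qed
  then have "topspace (cantor_power k) - (topspace (cantor_power k) - P R)
      \<in> boolean_combinations (cantor_power k)" for R
    by (intro boolean_combinations.intros)
  moreover have "topspace (cantor_power k) - (topspace (cantor_power k) - P R) = P R" for R
    unfolding top P_def by blast
  ultimately have P: "P R \<in> boolean_combinations (cantor_power k)" for R by simp
  have W: "W R \<in> boolean_combinations (cantor_power k)" for R
    unfolding W_def by (intro boolean_combinations.intros(1) openin_Union) auto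
  have "D = (\<Union>R\<in>Pow ({..<K} \<times> {..<K}). W R \<inter> P R)"
  proof
    show "D \<subseteq> (\<Union>R\<in>Pow ({..<K} \<times> {..<K}). W R \<inter> P R)"
    proof
      fix p assume p: "p \<in> D"
      define R where "R = {(i, j) \<in> {..<K} \<times> {..<K}. join k p b i = join k p b j}"
      obtain l where l: "\<forall>q\<in>box k l p.
          (\<forall>i<K. \<forall>j<K. join k p b i = join k p b j \<longrightarrow> join k q b i = join k q b j) \<longrightarrow> q \<in> D"
        using const[OF p] by blast
      have "box k l p \<inter> P R \<subseteq> D"
        using l by (auto simp: P_def R_def)
      then have "box k l p \<subseteq> W R" unfolding W_def using openin_box by blast
      moreover have "p \<in> box k l p" using D p by (auto simp: mem_box_iff)
      moreover have "p \<in> P R" using D p by (auto simp: P_def R_def)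
      moreover have "R \<in> Pow ({..<K} \<times> {..<K})" by (auto simp: R_def)
      ultimately show "p \<in> (\<Union>R\<in>Pow ({..<K} \<times> {..<K}). W R \<inter> P R)" by blast
    qed
  qed (auto simp: W_def)
  moreover have "(\<Union>R\<in>Pow ({..<K} \<times> {..<K}). W R \<inter> P R) \<in> boolean_combinations (cantor_power k)"
    using P W by (intro boolean_combinations_finite_UN boolean_combinations_Int) auto
  ultimately show ?thesis by simp
qed

lemma index_set_Pair: "D \<subseteq> {..<k} \<rightarrow>\<^sub>E UNIV \<Longrightarrow> index_set Pair k D = D"
proof -
  assume D: "D \<subseteq> {..<k} \<rightarrow>\<^sub>E UNIV"
  have "(\<lambda>j\<in>{..<k}. (fst (p j), snd (p j))) = p" if "p \<in> {..<k} \<rightarrow>\<^sub>E (UNIV :: (cantor \<times> nat) set)" for p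
    using that by (auto simp: fun_eq_iff PiE_iff extensional_def)
  then show ?thesis using D by (auto simp: index_set_def)
qed

lemma cantor_times_nat_eqpoll: "(UNIV :: (cantor \<times> nat) set) \<approx> (UNIV :: cantor set)"
proof (rule lepoll_antisym)
  \<comment> \<open>The even positions carry the point of the Cantor space, the odd ones the
    indicator function of the column.\<close>
  define f where "f z = (\<lambda>n. if even n then fst z (n div 2) else n div 2 = snd z)"
    for z :: "cantor \<times> nat"
  have "z = w" if "f z = f w" for z w
  proof (rule prod_eqI)
    have eq: "f z n = f w n" for n using that by simp
    show "fst z = fst w" using eq[of "2 * n" for n] by (auto simp: f_def)
    show "snd z = snd w" using eq[of "Suc (2 * snd z)"] by (simp add: f_def)
  qed
  then have "inj f" by (rule injI)
  then show "(UNIV :: (cantor \<times> nat) set) \<lesssim> (UNIV :: cantor set)"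
    unfolding lepoll_def by blast
  show "(UNIV :: cantor set) \<lesssim> (UNIV :: (cantor \<times> nat) set)"
    unfolding lepoll_def by (intro exI[of _ "\<lambda>\<eta>. (\<eta>, 0)"]) (auto simp: inj_def)
qed

section \<open>Definable sets of the limit model\<close>

context approximation
begin

lemma solutions_limit_subset: "solutions limit k \<phi> b \<subseteq> {..<k} \<rightarrow>\<^sub>E UNIV"
  by (auto simp: solutions_def)

lemma solutions_locally_constant:
  assumes \<phi>: "formula L (k + m) \<phi>" and p: "p \<in> solutions limit k \<phi> b"
  shows "\<exists>l. \<forall>q\<in>box k l p. (\<forall>i<k + m. \<forall>j<k + m. join k p b i = join k p b j \<longrightarrow>
    join k q b i = join k q b j) \<longrightarrow> q \<in> solutions limit k \<phi> b"
proof -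
  obtain l where l: "\<And>e'. \<forall>j<k + m. tr l (e' j) = tr l (join k p b j) \<Longrightarrow>
      \<forall>i<k + m. \<forall>j<k + m. join k p b i = join k p b j \<longrightarrow> e' i = e' j \<Longrightarrow>
      sat limit e' \<phi> \<longleftrightarrow> sat limit (join k p b) \<phi>"
    using sat_limit_locally_constant[OF \<phi>, of "join k p b"] by blast
  have "q \<in> solutions limit k \<phi> b"
    if q: "q \<in> box k l p"
      and eq: "\<forall>i<k + m. \<forall>j<k + m. join k p b i = join k p b j \<longrightarrow> join k q b i = join k q b j" for q
  proof -
    have "\<forall>j<k. tr l (q j) = tr l (p j)" using q by (simp add: mem_box_iff)
    then have "\<forall>j<k + m. tr l (join k q b j) = tr l (join k p b j)"
      using join_tr by blast
    from l[OF this eq] show ?thesis using p q by (simp add: solutions_def mem_box_iff)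
  qed
  then show ?thesis by blast
qed

lemma definable_boolean_combination:
  assumes "formula L (k + m) \<phi>"
  shows "solutions limit k \<phi> b \<in> boolean_combinations (cantor_power k)"
  by (rule boolean_combination_locally_constant[OF solutions_limit_subset solutions_locally_constant])
    (rule assms)

text \<open>At a non-degenerate solution \<open>p\<close>, the only coincidences between distinct
  positions are among the parameters, and these persist for every \<open>q\<close>. Hence a whole
  box around \<open>p\<close> consists of solutions, and boxes have positive measure.\<close>

lemma nondegenerate_positive_measure:
  assumes \<phi>: "formula L (k + m) \<phi>" and nondeg: "nondegenerate limit k m \<phi> b"
  shows "emeasure (\<Pi>\<^sub>M j\<in>{..<k}. mu) (solutions limit k \<phi> b) > 0"
proof -
  obtain p where p: "p \<in> solutions limit k \<phi> b" "inj_on p {..<k}" "p ` {..<k} \<inter> b ` {..<m} = {}"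
    using nondeg by (auto simp: nondegenerate_def)
  obtain l where l: "\<forall>q\<in>box k l p. (\<forall>i<k + m. \<forall>j<k + m. join k p b i = join k p b j \<longrightarrow>
      join k q b i = join k q b j) \<longrightarrow> q \<in> solutions limit k \<phi> b"
    using solutions_locally_constant[OF \<phi> p(1)] by blast
  have disj: "p i \<noteq> b j" if "i < k" "j < m" for i j using p(3) that by blast
  have "join k q b i = join k q b j"
    if ij: "i < k + m" "j < k + m" "join k p b i = join k p b j" for q i j
  proof (cases "i < k"; cases "j < k")
    assume "i < k" "j < k"
    then have "i = j" using ij(3) inj_onD[OF p(2), of i j] by (simp add: join_def)
    then show ?thesis by simp
  next
    assume "i < k" "\<not> j < k"
    then show ?thesis using ij disj[of i "j - k"] by (simp add: join_def)
  next
    assume "\<not> i < k" "j < k"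
    then have "p j = b (i - k)" "i - k < m" using ij by (simp_all add: join_def)
    then show ?thesis using disj \<open>j < k\<close> by blast
  next
    assume "\<not> i < k" "\<not> j < k"
    then show ?thesis using ij(3) by (simp add: join_def)
  qed
  then have "box k l p \<subseteq> solutions limit k \<phi> b" using l by blast
  moreover have "solutions limit k \<phi> b \<in> sets (\<Pi>\<^sub>M j\<in>{..<k}. mu)"
    by (intro boolean_combinations_sets definable_boolean_combination[OF \<phi>])
  ultimately have "emeasure (\<Pi>\<^sub>M j\<in>{..<k}. mu) (box k l p) \<le>
      emeasure (\<Pi>\<^sub>M j\<in>{..<k}. mu) (solutions limit k \<phi> b)"
    by (rule emeasure_mono)
  then show ?thesis using emeasure_box_pos by (rule order_less_le_trans[rotated])
qed

end

theorem theorem6p1p4: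
  fixes L :: "('f, 'r) language"
    and M :: "('f, 'r, 'a) fo_struct"
  assumes "countable_language L"
    and "is_struct L M"
    and "trivial_dcl L M"
  shows "\<forall>\<Delta> :: (nat \<times> ('f, 'r) fm set) set.
    countable \<Delta> \<and> (\<forall>(n, p) \<in> \<Delta>. is_type L M n p \<and> omits M n p) \<longrightarrow>
    (\<exists>(N :: ('f, 'r, cantor \<times> nat) fo_struct) (a :: cantor \<Rightarrow> nat \<Rightarrow> cantor \<times> nat).
       is_struct L N \<and> elem_equiv L M N \<and> univ N \<approx> (UNIV :: (nat \<Rightarrow> bool) set) \<and>
       bij_betw (\<lambda>(\<eta>, i). a \<eta> i) UNIV (univ N) \<and>
       univ N = (\<Union>i. range (\<lambda>\<eta>. a \<eta> i)) \<and>
       disjoint_family (\<lambda>i. range (\<lambda>\<eta>. a \<eta> i)) \<and>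
       (\<forall>i. asymptotically_similar L N (\<lambda>\<eta>. a \<eta> i)) \<and>
       (\<forall>k m \<phi>. \<forall>b \<in> {..<m} \<rightarrow>\<^sub>E univ N. formula L (k + m) \<phi> \<longrightarrow>
          index_set a k (solutions N k \<phi> b)
            \<in> boolean_combinations (product_topology (\<lambda>_. euclidean) {..<k})) \<and>
       (\<forall>k m \<phi>. \<forall>b \<in> {..<m} \<rightarrow>\<^sub>E univ N. formula L (k + m) \<phi> \<and> nondegenerate N k m \<phi> b \<longrightarrow>
          emeasure (\<Pi>\<^sub>M j\<in>{..<k}. mu) (index_set a k (solutions N k \<phi> b)) > 0) \<and>
       (atomic L M \<longrightarrow> atomic L N) \<and>
       (\<forall>(n, p) \<in> \<Delta>. omits N n p))"
proof (intro allI impI)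
  fix \<Delta> :: "(nat \<times> ('f, 'r) fm set) set"
  assume \<Delta>: "countable \<Delta> \<and> (\<forall>(n, p) \<in> \<Delta>. is_type L M n p \<and> omits M n p)"
  \<comment> \<open>Atomicity of \<open>M\<close> means that \<open>M\<close> omits, for each
    \<open>k\<close>, the set of negations of complete formulas in \<open>k\<close> variables.
    Adding these countably many sets to \<open>\<Delta>\<close> makes one and the same limit atomic
    as well; if \<open>M\<close> is not atomic, it realizes one of them and none is added.\<close>
  define \<Gamma> where "\<Gamma> = (if atomic L M then range (\<lambda>k. (k, Neg ` {\<phi>. complete_formula L M k \<phi>})) else {})"
  interpret trivial_dcl_struct L M by unfold_locales (rule assms)+
  have "countable (\<Delta> \<union> \<Gamma>)" using \<Delta> by (simp add: \<Gamma>_def)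
  moreover have form: "formula L k \<phi>" if "(k, p) \<in> \<Delta> \<union> \<Gamma>" "\<phi> \<in> p" for k p \<phi>
    using that(1)
  proof
    assume "(k, p) \<in> \<Delta>"
    then have "is_type L M k p" using \<Delta> by blast
    then show ?thesis using that(2) by (simp add: is_type_def)
  next
    assume "(k, p) \<in> \<Gamma>"
    then show ?thesis
      using that(2) by (auto simp: \<Gamma>_def complete_formula_def formula_def split: if_splits)
  qed
  moreover have "omits M k p" if "(k, p) \<in> \<Delta> \<union> \<Gamma>" for k p
    using that
  proof
    assume "(k, p) \<in> \<Delta>"
    then show ?thesis using \<Delta> by blast
  next
    assume "(k, p) \<in> \<Gamma>"
    then have "atomic L M" "p = Neg ` {\<phi>. complete_formula L M k \<phi>}"
      by (auto simp: \<Gamma>_def split: if_splits)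
    then show ?thesis by (fastforce simp: atomic_def omits_def)
  qed
  ultimately obtain c n F where "approximation L M c n F (\<Delta> \<union> \<Gamma>)"
    using ex_approximation[OF assms(1)] by blast
  then interpret approximation L M c n F "\<Delta> \<union> \<Gamma>" .
  have index: "index_set Pair k (solutions limit k \<phi> b) = solutions limit k \<phi> b" for k \<phi> b
    by (intro index_set_Pair solutions_limit_subset)
  show "\<exists>(N :: ('f, 'r, cantor \<times> nat) fo_struct) (a :: cantor \<Rightarrow> nat \<Rightarrow> cantor \<times> nat).
       is_struct L N \<and> elem_equiv L M N \<and> univ N \<approx> (UNIV :: (nat \<Rightarrow> bool) set) \<and>
       bij_betw (\<lambda>(\<eta>, i). a \<eta> i) UNIV (univ N) \<and>
       univ N = (\<Union>i. range (\<lambda>\<eta>. a \<eta> i)) \<and>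
       disjoint_family (\<lambda>i. range (\<lambda>\<eta>. a \<eta> i)) \<and>
       (\<forall>i. asymptotically_similar L N (\<lambda>\<eta>. a \<eta> i)) \<and>
       (\<forall>k m \<phi>. \<forall>b \<in> {..<m} \<rightarrow>\<^sub>E univ N. formula L (k + m) \<phi> \<longrightarrow>
          index_set a k (solutions N k \<phi> b)
            \<in> boolean_combinations (product_topology (\<lambda>_. euclidean) {..<k})) \<and>
       (\<forall>k m \<phi>. \<forall>b \<in> {..<m} \<rightarrow>\<^sub>E univ N. formula L (k + m) \<phi> \<and> nondegenerate N k m \<phi> b \<longrightarrow>
          emeasure (\<Pi>\<^sub>M j\<in>{..<k}. mu) (index_set a k (solutions N k \<phi> b)) > 0) \<and>
       (atomic L M \<longrightarrow> atomic L N) \<and>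
       (\<forall>(n, p) \<in> \<Delta>. omits N n p)"
  proof (intro exI[of _ limit] exI[of _ Pair] conjI)
    show "univ limit \<approx> (UNIV :: (nat \<Rightarrow> bool) set)" by (simp add: cantor_times_nat_eqpoll)
    show "bij_betw (\<lambda>(\<eta>, i). (\<eta>, i)) UNIV (univ limit)" by (simp add: bij_betw_def inj_on_def)
    show "univ limit = (\<Union>i. range (\<lambda>\<eta>. (\<eta>, i)))" by auto
    show "disjoint_family (\<lambda>i. range (\<lambda>\<eta>. (\<eta>, i)))" by (auto simp: disjoint_family_on_def)
    show "\<forall>i. asymptotically_similar L limit (\<lambda>\<eta>. (\<eta>, i))"
      by (simp add: asymptotically_similar_limit)
    show "\<forall>k m \<phi>. \<forall>b \<in> {..<m} \<rightarrow>\<^sub>E univ limit. formula L (k + m) \<phi> \<longrightarrow>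
        index_set Pair k (solutions limit k \<phi> b)
          \<in> boolean_combinations (product_topology (\<lambda>_. euclidean) {..<k})"
      unfolding index using definable_boolean_combination by blast
    show "\<forall>k m \<phi>. \<forall>b \<in> {..<m} \<rightarrow>\<^sub>E univ limit. formula L (k + m) \<phi> \<and> nondegenerate limit k m \<phi> b \<longrightarrow>
        emeasure (\<Pi>\<^sub>M j\<in>{..<k}. mu) (index_set Pair k (solutions limit k \<phi> b)) > 0"
      unfolding index using nondegenerate_positive_measure by blast
    show "atomic L M \<longrightarrow> atomic L limit"
    proof
      assume "atomic L M"
      then show "atomic L limit" by (intro atomic_limit) (simp add: \<Gamma>_def)
    qed
    show "\<forall>(n, p) \<in> \<Delta>. omits limit n p"
      using omits_limit form by blast
  qed (rule struct_limit elem_equiv_limit)+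
qed

end
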